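(* Let $0<\alpha<1$, let $\Omega\subset\mathbb R^N$ be bounded and connected, and let $m\in L^\infty(\Omega)$. Set $\Omega^+=\{m>0\}$ and assume that $\Omega^+\Subset\Omega$ is nonempty and connected, $\partial\Omega^+\in C^{1,1}$, and, for some $m_0,q_0>0$, $$m\ge m_0\ \text{ a.e. in }\Omega^+,\qquad m\le-q_0\ \text{ a.e. in }\Omega\setminus\overline{\Omega^+}.$$ For $\lambda<0$ put $K_\lambda=\operatorname{supp}u_\lambda^+$ and $\Gamma_\lambda=\partial K_\lambda\cap\Omega$. Then there exists $C>0$ such that, for all sufficiently negative $\lambda$, $$\overline{\Omega^+}\subset K_\lambda\subset\{x\in\Omega:\operatorname{dist}(x,\overline{\Omega^+})<C|\lambda|^{-1/2}\}.$$ Consequently, $d_H(K_\lambda,\overline{\Omega^+})\le C|\lambda|^{-1/2}\to0$ as $\lambda\to-\infty$ and, possibly enlarging $C$, $d_H(\Gamma_\lambda,\partial\Omega^+)\le C|\lambda|^{-1/2}\to0$.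
   Context: $\Omega$ is a bounded connected domain in $\mathbb R^N$, $N\ge1$, with sufficiently smooth boundary (standing assumption); $\Omega^+$ is an open set (a domain). $d_H$ is the Hausdorff distance between compact subsets of $\overline\Omega$. Problem $(P_\lambda)$: $-\Delta u=\lambda u+m(x)|u|^{\alpha-1}u$ in $\Omega$, $u=0$ on $\partial\Omega$ (weak solutions in $H_0^1(\Omega)$). $H_\lambda(u)=\int_\Omega(|\nabla u|^2-\lambda u^2)dx$, $M(u)=\int_\Omega m|u|^{\alpha+1}dx$, $E_\lambda(u)=\frac12H_\lambda(u)-\frac1{\alpha+1}M(u)$, and $\mathcal N_\lambda^+=\{u\in H_0^1(\Omega)\setminus\{0\}:H_\lambda(u)=M(u),\ H_\lambda(u)-\alpha M(u)>0\}$. For $\lambda<0$, $u_\lambda^+$ denotes a non-negative weak solution of $(P_\lambda)$ belonging to $\mathcal N_\lambda^+$ with $E_\lambda(u_\lambda^+)=\inf_{\mathcal N_\lambda^+}E_\lambda$ (the solution constructed in the paper; such solutions exist when $|\Omega^+|>0$, are continuous on $\overline\Omega$, and one is fixed for each $\lambda$). *)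

theory Defs
  imports "HOL-Analysis.Analysis"
begin

section \<open>Function spaces\<close>

text \<open>
  Functions on an open set \<open>\<Omega>\<close> of a Euclidean space are total functions whose values outside
  \<open>\<Omega>\<close> play no role, and elements of Lebesgue and Sobolev spaces are represented by functions rather
  than by equivalence classes. All notions below other than the support are invariant under changes
  on null sets.
\<close>

definition sq_integrable :: "'a::euclidean_space set \<Rightarrow> ('a \<Rightarrow> 'b::euclidean_space) \<Rightarrow> bool" where
  "sq_integrable \<Omega> f \<longleftrightarrow>
     f \<in> borel_measurable (lebesgue_on \<Omega>) \<and> integrable (lebesgue_on \<Omega>) (\<lambda>x. (norm (f x))\<^sup>2)"

definition ess_bounded :: "'a::euclidean_space set \<Rightarrow> ('a \<Rightarrow> real) \<Rightarrow> bool" where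
  "ess_bounded \<Omega> f \<longleftrightarrow>
     f \<in> borel_measurable (lebesgue_on \<Omega>) \<and> (\<exists>B. AE x in lebesgue_on \<Omega>. \<bar>f x\<bar> \<le> B)"

primrec Ck :: "nat \<Rightarrow> ('a::euclidean_space \<Rightarrow> real) \<Rightarrow> bool" where
  "Ck 0 f \<longleftrightarrow> continuous_on UNIV f"
| "Ck (Suc k) f \<longleftrightarrow>
     (\<forall>x. f differentiable (at x)) \<and> (\<forall>b\<in>Basis. Ck k (\<lambda>x. frechet_derivative f (at x) b))"

definition test_functions :: "'a::euclidean_space set \<Rightarrow> ('a \<Rightarrow> real) set" where
  "test_functions \<Omega> =
     {\<phi>. (\<forall>k. Ck k \<phi>) \<and> compact (closure (support_on UNIV \<phi>)) \<and> closure (support_on UNIV \<phi>) \<subseteq> \<Omega>}"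

definition is_weak_grad ::
    "'a::euclidean_space set \<Rightarrow> ('a \<Rightarrow> real) \<Rightarrow> ('a \<Rightarrow> 'a) \<Rightarrow> bool" where
  "is_weak_grad \<Omega> u G \<longleftrightarrow> sq_integrable \<Omega> G \<and>
     (\<forall>\<phi>\<in>test_functions \<Omega>. \<forall>b\<in>Basis.
        (LINT x|lebesgue_on \<Omega>. u x * frechet_derivative \<phi> (at x) b)
          = - (LINT x|lebesgue_on \<Omega>. (G x \<bullet> b) * \<phi> x))"

definition H1 :: "'a::euclidean_space set \<Rightarrow> ('a \<Rightarrow> real) set" where
  "H1 \<Omega> = {u. sq_integrable \<Omega> u \<and> (\<exists>G. is_weak_grad \<Omega> u G)}"

text \<open>The weak gradient is unique almost everywhere; a representative is chosen.\<close>

definition weak_grad :: "'a::euclidean_space set \<Rightarrow> ('a \<Rightarrow> real) \<Rightarrow> 'a \<Rightarrow> 'a" where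
  "weak_grad \<Omega> u = (SOME G. is_weak_grad \<Omega> u G)"

definition H1_norm :: "'a::euclidean_space set \<Rightarrow> ('a \<Rightarrow> real) \<Rightarrow> real" where
  "H1_norm \<Omega> u = sqrt (LINT x|lebesgue_on \<Omega>. (u x)\<^sup>2 + (norm (weak_grad \<Omega> u x))\<^sup>2)"

definition H10 :: "'a::euclidean_space set \<Rightarrow> ('a \<Rightarrow> real) set" where
  "H10 \<Omega> = {u \<in> H1 \<Omega>. \<exists>\<phi>. (\<forall>n. \<phi> n \<in> test_functions \<Omega>) \<and>
                            (\<lambda>n. H1_norm \<Omega> (\<lambda>x. \<phi> n x - u x)) \<longlonglongrightarrow> 0}"


section \<open>Boundary regularity and Hausdorff distance\<close>

definition C11_function :: "('a::euclidean_space \<Rightarrow> real) \<Rightarrow> bool" where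
  "C11_function g \<longleftrightarrow>
     (\<exists>G L. (\<forall>x. (g has_derivative (\<lambda>h. G x \<bullet> h)) (at x)) \<and> L-lipschitz_on UNIV G)"

text \<open>
  Near each boundary point the set lies strictly above the graph, in some direction \<open>\<nu>\<close>, of a
  \<open>C\<^sup>1\<^sup>,\<^sup>1\<close> function \<open>g\<close> over the hyperplane orthogonal to \<open>\<nu>\<close>. Only the values of \<open>g\<close> on that
  hyperplane matter; in dimension one it is a point.
\<close>

definition C11_boundary :: "'a::euclidean_space set \<Rightarrow> bool" where
  "C11_boundary U \<longleftrightarrow>
     (\<forall>p\<in>frontier U. \<exists>r>0. \<exists>\<nu> g. norm \<nu> = 1 \<and> C11_function g \<and>
        U \<inter> ball p r = {y \<in> ball p r. y \<bullet> \<nu> > g (y - (y \<bullet> \<nu>) *\<^sub>R \<nu>)})"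

text \<open>Meaningful for nonempty bounded sets only: suprema of reals are used.\<close>

definition hausdorff_dist :: "'a::metric_space set \<Rightarrow> 'a set \<Rightarrow> real" where
  "hausdorff_dist A B = max (SUP a\<in>A. infdist a B) (SUP b\<in>B. infdist b A)"


section \<open>The equation and its variational structure\<close>

definition weak_solution ::
    "'a::euclidean_space set \<Rightarrow> ('a \<Rightarrow> real) \<Rightarrow> real \<Rightarrow> real \<Rightarrow> ('a \<Rightarrow> real) \<Rightarrow> bool" where
  "weak_solution \<Omega> m \<alpha> l u \<longleftrightarrow> u \<in> H10 \<Omega> \<and>
     (\<forall>\<phi>\<in>H10 \<Omega>.
        (LINT x|lebesgue_on \<Omega>. weak_grad \<Omega> u x \<bullet> weak_grad \<Omega> \<phi> x)
          = l * (LINT x|lebesgue_on \<Omega>. u x * \<phi> x)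
            + (LINT x|lebesgue_on \<Omega>. m x * (\<bar>u x\<bar> powr (\<alpha> - 1) * u x) * \<phi> x))"

definition H_form :: "'a::euclidean_space set \<Rightarrow> real \<Rightarrow> ('a \<Rightarrow> real) \<Rightarrow> real" where
  "H_form \<Omega> l u = (LINT x|lebesgue_on \<Omega>. (norm (weak_grad \<Omega> u x))\<^sup>2 - l * (u x)\<^sup>2)"

definition M_form ::
    "'a::euclidean_space set \<Rightarrow> ('a \<Rightarrow> real) \<Rightarrow> real \<Rightarrow> ('a \<Rightarrow> real) \<Rightarrow> real" where
  "M_form \<Omega> m \<alpha> u = (LINT x|lebesgue_on \<Omega>. m x * \<bar>u x\<bar> powr (\<alpha> + 1))"

definition energy ::
    "'a::euclidean_space set \<Rightarrow> ('a \<Rightarrow> real) \<Rightarrow> real \<Rightarrow> real \<Rightarrow> ('a \<Rightarrow> real) \<Rightarrow> real" where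
  "energy \<Omega> m \<alpha> l u = 1 / 2 * H_form \<Omega> l u - 1 / (\<alpha> + 1) * M_form \<Omega> m \<alpha> u"

definition nehari_plus ::
    "'a::euclidean_space set \<Rightarrow> ('a \<Rightarrow> real) \<Rightarrow> real \<Rightarrow> real \<Rightarrow> ('a \<Rightarrow> real) set" where
  "nehari_plus \<Omega> m \<alpha> l =
     {u \<in> H10 \<Omega>. \<not> (AE x in lebesgue_on \<Omega>. u x = 0) \<and>
        H_form \<Omega> l u = M_form \<Omega> m \<alpha> u \<and>
        H_form \<Omega> l u - \<alpha> * M_form \<Omega> m \<alpha> u > 0}"

definition nehari_plus_minimizer ::
    "'a::euclidean_space set \<Rightarrow> ('a \<Rightarrow> real) \<Rightarrow> real \<Rightarrow> real \<Rightarrow> ('a \<Rightarrow> real) \<Rightarrow> bool" where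
  "nehari_plus_minimizer \<Omega> m \<alpha> l u \<longleftrightarrow>
     weak_solution \<Omega> m \<alpha> l u \<and> (AE x in lebesgue_on \<Omega>. 0 \<le> u x) \<and> u \<in> nehari_plus \<Omega> m \<alpha> l \<and>
     energy \<Omega> m \<alpha> l u = (INF v\<in>nehari_plus \<Omega> m \<alpha> l. energy \<Omega> m \<alpha> l v)"

text \<open>The support of \<open>u\<close> as a subset of \<open>closure \<Omega>\<close>, and the part of its boundary inside \<open>\<Omega>\<close>.\<close>

definition supp :: "'a::euclidean_space set \<Rightarrow> ('a \<Rightarrow> real) \<Rightarrow> 'a set" where
  "supp \<Omega> u = closure (support_on \<Omega> u)"

definition free_boundary :: "'a::euclidean_space set \<Rightarrow> ('a \<Rightarrow> real) \<Rightarrow> 'a set" where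
  "free_boundary \<Omega> u = frontier (supp \<Omega> u) \<inter> \<Omega>"

end

theory Submission
  imports Defs
begin

text \<open>
  Everything follows from comparing \<open>u\<close> with smooth barriers. Let \<open>ramp t = exp (-1/t)\<close> for
  \<open>t > 0\<close> and \<open>0\<close> otherwise. If test functions \<open>\<phi> n\<close> converge to \<open>u\<close> in \<open>H\<^sup>1\<close>
  and \<open>w\<close> is smooth and nonnegative, then \<open>ramp (\<phi> n - w)\<close> is again a test function; inserting it into
  the equation and letting \<open>n\<close> tend to infinity shows that \<open>u \<le> w\<close> as soon as \<open>w\<close> is a strict
  supersolution wherever \<open>u > w\<close>. Constants give \<open>u \<le> (B/|\<lambda>|)\<^bsup>1/(1-\<alpha>)\<^esup>\<close> with
  \<open>B\<close> a bound for \<open>|m|\<close>. On a ball of radius \<open>R\<close> around \<open>z\<close> that avoids the closure of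
  \<open>\<Omega>\<^sup>+\<close>, the barrier \<open>(\<kappa> |x - z|\<^sup>2)\<^bsup>1/(1-\<alpha>)\<^esup>\<close> then forces \<open>u z = 0\<close>
  once \<open>\<kappa> R\<^sup>2 \<ge> B/|\<lambda>|\<close>, which is the upper inclusion. Comparison from below with the Gaussian barrier of
  Hopf gives the strong maximum principle on \<open>\<Omega>\<^sup>+\<close>, where \<open>u\<close> does not vanish
  identically because \<open>M(u) > 0\<close>, hence the lower inclusion. For the free boundary, the boundary regularity
  supplies exterior points at distance comparable to \<open>R\<close> from the closure of \<open>\<Omega>\<^sup>+\<close> near every point of
  its boundary, and the segment joining the two meets the free boundary.
\<close>

subsection \<open>Smooth functions\<close>

abbreviation partial :: "'a::euclidean_space \<Rightarrow> ('a \<Rightarrow> real) \<Rightarrow> 'a \<Rightarrow> real" where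
  "partial b f x \<equiv> frechet_derivative f (at x) b"

definition smooth :: "('a::euclidean_space \<Rightarrow> real) \<Rightarrow> bool" where
  "smooth f \<longleftrightarrow> (\<forall>k. Ck k f)"

lemma Ck_mono_Suc: "Ck (Suc k) f \<Longrightarrow> Ck k f"
proof (induction k arbitrary: f)
  case 0
  then show ?case
    by (auto simp: continuous_on_eq_continuous_at intro: differentiable_imp_continuous_within)
next
  case (Suc k)
  then show ?case
    by (metis Ck.simps(2))
qed

lemma Ck_differentiable: "Ck (Suc k) f \<Longrightarrow> f differentiable (at x)"
  by simp

lemma Ck_continuous: "Ck k f \<Longrightarrow> continuous_on UNIV f"
  by (induction k) (auto simp: continuous_on_eq_continuous_at intro: differentiable_imp_continuous_within)

lemma smooth_differentiable: "smooth f \<Longrightarrow> f differentiable (at x)"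
  unfolding smooth_def using Ck_differentiable by blast

lemma smooth_has_derivative: "smooth f \<Longrightarrow> (f has_derivative frechet_derivative f (at x)) (at x)"
  using smooth_differentiable frechet_derivative_works by blast

lemma smooth_continuous: "smooth f \<Longrightarrow> continuous_on S f"
  unfolding smooth_def using Ck_continuous continuous_on_subset by blast

lemma smooth_partial: "smooth f \<Longrightarrow> b \<in> Basis \<Longrightarrow> smooth (partial b f)"
  unfolding smooth_def using Ck.simps(2) by blast

lemma partial_unique:
  assumes "\<And>x. (f has_derivative f' x) (at x)"
  shows "partial b f = (\<lambda>x. f' x b)"
  by (rule ext, rule fun_cong[OF frechet_derivative_at[OF assms, symmetric]])

text \<open>Admits an explicit formula for the derivative in place of the one chosen by
  \<open>frechet_derivative\<close>.\<close>

lemma Ck_SucI: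
  assumes "\<And>x. (f has_derivative f' x) (at x)" and "\<And>b. b \<in> Basis \<Longrightarrow> Ck k (\<lambda>x. f' x b)"
  shows "Ck (Suc k) f"
  using assms(2) partial_unique[OF assms(1)] assms(1) by (auto simp: differentiable_def)

lemma Ck_const: "Ck k (\<lambda>_. c)"
proof (induction k arbitrary: c)
  case (Suc k)
  then show ?case by (intro Ck_SucI[where f'="\<lambda>_ _. 0"]) auto
qed simp

lemma Ck_inner: "Ck k (\<lambda>x. x \<bullet> c)"
proof (cases k)
  case (Suc k)
  have "Ck (Suc k) (\<lambda>x. x \<bullet> c)"
    by (rule Ck_SucI[where f'="\<lambda>_ h. h \<bullet> c"]) (auto intro!: derivative_eq_intros Ck_const)
  then show ?thesis using Suc by simp
qed (simp add: continuous_intros)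

lemma Ck_add: "Ck k f \<Longrightarrow> Ck k g \<Longrightarrow> Ck k (\<lambda>x. f x + g x)"
proof (induction k arbitrary: f g)
  case (Suc k)
  have "f differentiable at x" "g differentiable at x" for x
    using Suc.prems by auto
  then show ?case
    using Suc.prems
    by (intro Ck_SucI[where f'="\<lambda>x h. partial h f x + partial h g x"] has_derivative_add Suc.IH)
       (auto simp: frechet_derivative_works)
qed (simp add: continuous_intros)

lemma Ck_mult: "Ck k f \<Longrightarrow> Ck k g \<Longrightarrow> Ck k (\<lambda>x. f x * g x)"
proof (induction k arbitrary: f g)
  case (Suc k)
  have "f differentiable at x" "g differentiable at x" for x
    using Suc.prems by auto
  moreover have "Ck k f" "Ck k g"
    using Suc.prems Ck_mono_Suc by blast+
  ultimately show ?case
    using Suc.prems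
    by (intro Ck_SucI[where f'="\<lambda>x h. f x * partial h g x + partial h f x * g x"]
          has_derivative_mult Ck_add Suc.IH)
       (auto simp: frechet_derivative_works)
qed (simp add: continuous_intros)

text \<open>The whole sequence of derivatives \<open>G n\<close> is carried along because the chain
  rule turns \<open>G n\<close> into \<open>G (Suc n)\<close>, so the induction on \<open>k\<close>
  must hold for all \<open>n\<close> at once. The set \<open>S\<close> admits outer functions, such
  as powers, that are smooth only on part of the line.\<close>

lemma Ck_compose:
  assumes "\<And>n t. t \<in> S \<Longrightarrow> (G n has_real_derivative G (Suc n) t) (at t)" and "range f \<subseteq> S"
  shows "Ck k f \<Longrightarrow> Ck k (\<lambda>x. G n (f x))"
  using assms(2)
proof (induction k arbitrary: f n)
  case 0
  then have "isCont (G n) (f x)" "isCont f x" for x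
    using assms(1) DERIV_isCont by (blast, simp add: continuous_on_eq_continuous_at)
  then have "isCont (\<lambda>x. G n (f x)) x" for x
    using isCont_o2 by blast
  then show ?case
    by (simp add: continuous_on_eq_continuous_at)
next
  case (Suc k)
  have f: "(f has_derivative frechet_derivative f (at x)) (at x)" for x
    using Suc.prems by (simp add: frechet_derivative_works)
  have G: "(G n has_derivative (\<lambda>h. h * G (Suc n) (f x))) (at (f x))" for x
    using assms(1) Suc.prems(2) unfolding has_field_derivative_def by (simp add: mult_commute_abs image_subset_iff)
  show ?case
  proof (rule Ck_SucI[where f'="\<lambda>x h. partial h f x * G (Suc n) (f x)"])
    show "((\<lambda>x. G n (f x)) has_derivative (\<lambda>h. partial h f x * G (Suc n) (f x))) (at x)" for x
      using has_derivative_compose[OF f G] .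
    show "Ck k (\<lambda>x. partial b f x * G (Suc n) (f x))" if "b \<in> Basis" for b
      using that Suc.prems Ck_mono_Suc[OF Suc.prems(1)] by (intro Ck_mult Suc.IH) auto
  qed
qed

lemma smooth_const: "smooth (\<lambda>_. c)"
  and smooth_inner: "smooth (\<lambda>x. x \<bullet> a)"
  and smooth_add: "smooth f \<Longrightarrow> smooth g \<Longrightarrow> smooth (\<lambda>x. f x + g x)"
  and smooth_mult: "smooth f \<Longrightarrow> smooth g \<Longrightarrow> smooth (\<lambda>x. f x * g x)"
  by (simp_all add: smooth_def Ck_const Ck_inner Ck_add Ck_mult)

lemma smooth_diff: "smooth f \<Longrightarrow> smooth g \<Longrightarrow> smooth (\<lambda>x. f x - g x)"
  using smooth_add[of f "\<lambda>x. (-1) * g x"] smooth_mult[OF smooth_const, of g "-1"] by simp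

lemma smooth_sum: "(\<And>i. i \<in> I \<Longrightarrow> smooth (f i)) \<Longrightarrow> smooth (\<lambda>x. \<Sum>i\<in>I. f i x)"
  by (induction I rule: infinite_finite_induct) (auto intro: smooth_const smooth_add)

lemma smooth_prod: "(\<And>i. i \<in> I \<Longrightarrow> smooth (f i)) \<Longrightarrow> smooth (\<lambda>x. \<Prod>i\<in>I. f i x)"
  by (induction I rule: infinite_finite_induct) (auto intro: smooth_const smooth_mult)

lemma smooth_dist_sq: "smooth (\<lambda>x. (norm (x - z))\<^sup>2)"
proof -
  have "smooth (\<lambda>x. \<Sum>b\<in>Basis. (x \<bullet> b - z \<bullet> b) * (x \<bullet> b - z \<bullet> b))"
    by (intro smooth_sum smooth_mult smooth_diff smooth_inner smooth_const)
  moreover have "(\<Sum>b\<in>Basis. (x \<bullet> b - z \<bullet> b) * (x \<bullet> b - z \<bullet> b)) = (norm (x - z))\<^sup>2" for x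
    unfolding power2_norm_eq_inner by (subst euclidean_inner) (simp add: inner_diff_left)
  ultimately show ?thesis by simp
qed

lemma smooth_compose:
  assumes "\<And>n t. t \<in> S \<Longrightarrow> (G n has_real_derivative G (Suc n) t) (at t)" and "range f \<subseteq> S" and "smooth f"
  shows "smooth (\<lambda>x. G n (f x))"
  using Ck_compose[of S G, OF assms(1,2)] assms(3) unfolding smooth_def by blast

lemma smooth_exp: "smooth f \<Longrightarrow> smooth (\<lambda>x. exp (f x))"
  by (rule smooth_compose[of UNIV "\<lambda>_. exp" f 0, simplified]) auto

lemma smooth_powr:
  assumes "smooth f" and "\<And>x. 0 < f x"
  shows "smooth (\<lambda>x. f x powr a)"
proof -
  \<comment> \<open>\<open>G n\<close> is the \<open>n\<close>-th derivative of
    \<open>t powr a\<close> on the positive half-line; the product is the falling factorial.\<close>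
  define G where "G n t = (\<Prod>i<n. a - real i) * t powr (a - real n)" for n t
  have "(G n has_real_derivative G (Suc n) t) (at t)" if "t \<in> {0<..}" for n t
  proof -
    have "((\<lambda>t. t powr (a - real n)) has_real_derivative (a - real n) * t powr (a - real n - 1)) (at t)"
      using that by (intro has_real_derivative_powr) simp
    from DERIV_cmult[OF this, of "\<Prod>i<n. a - real i"] show ?thesis
      unfolding G_def by (simp add: mult.assoc diff_diff_eq add.commute)
  qed
  then have "smooth (\<lambda>x. G 0 (f x))"
    using assms by (intro smooth_compose[of "{0<..}" G]) auto
  then show ?thesis by (simp add: G_def)
qed

section \<open>The flat function exp (-1/t) as a smooth cutoff\<close>

definition ramp :: "real \<Rightarrow> real" where
  "ramp t = (if 0 < t then exp (- 1 / t) else 0)"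

definition ramp_deriv :: "real \<Rightarrow> real" where
  "ramp_deriv t = (if 0 < t then exp (- 1 / t) / t\<^sup>2 else 0)"

text \<open>For \<open>t > 0\<close> the \<open>n\<close>-th derivative of \<open>ramp\<close> is \<open>poly (ramp_poly n) (1 / t) * exp (- 1 / t)\<close>.\<close>

primrec ramp_poly :: "nat \<Rightarrow> real poly" where
  "ramp_poly 0 = 1"
| "ramp_poly (Suc n) = [:0, 0, 1:] * (ramp_poly n - pderiv (ramp_poly n))"

lemma poly_times_exp_tendsto_0: "((\<lambda>s. poly p s / exp s) \<longlongrightarrow> (0::real)) at_top"
proof -
  have "((\<lambda>s. \<Sum>i\<le>degree p. coeff p i * (s ^ i / exp s)) \<longlongrightarrow> (\<Sum>i\<le>degree p. coeff p i * 0)) at_top"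
    by (intro tendsto_intros tendsto_power_div_exp_0)
  then show ?thesis
    by (simp add: poly_altdef sum_divide_distrib)
qed

text \<open>In the variable s = 1/t, differentiation in t is multiplication of d/ds by -s^2, which
  turns p(s) exp(-s) into s^2 (p - p')(s) exp(-s). The delicate point is t = 0, where exponential
  decay beats every polynomial in s.\<close>

lemma ramp_poly_has_derivative:
  defines "G \<equiv> \<lambda>p t. if 0 < t then poly p (1 / t) * exp (- 1 / t) else (0::real)"
  shows "(G p has_real_derivative G ([:0, 0, 1:] * (p - pderiv p)) t) (at t)"
proof (cases t "0::real" rule: linorder_cases)
  case less
  have "((\<lambda>_. 0) has_real_derivative 0) (at t)" by simp
  then have "(G p has_real_derivative 0) (at t)"
    by (rule has_field_derivative_transform_within_open[where S="{..<0}"]) (use less in \<open>auto simp: G_def\<close>)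
  then show ?thesis using less by (simp add: G_def)
next
  case greater
  have "((\<lambda>t. poly p (1 / t) * exp (- 1 / t)) has_real_derivative
        (poly (pderiv p) (1 / t) * (- 1 / t\<^sup>2)) * exp (- 1 / t) + (exp (- 1 / t) * (1 / t\<^sup>2)) * poly p (1 / t)) (at t)"
    using greater
    by (auto intro!: derivative_eq_intros DERIV_chain2[OF poly_DERIV] simp: power2_eq_square field_simps)
  then have "(G p has_real_derivative (poly (pderiv p) (1 / t) * (- 1 / t\<^sup>2)) * exp (- 1 / t) + (exp (- 1 / t) * (1 / t\<^sup>2)) * poly p (1 / t)) (at t)"
    by (rule has_field_derivative_transform_within_open[where S="{0<..}"]) (use greater in \<open>auto simp: G_def\<close>)
  also have "(poly (pderiv p) (1 / t) * (- 1 / t\<^sup>2)) * exp (- 1 / t) + (exp (- 1 / t) * (1 / t\<^sup>2)) * poly p (1 / t)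
      = G ([:0, 0, 1:] * (p - pderiv p)) t"
    using greater by (simp add: G_def power2_eq_square field_simps)
  finally show ?thesis .
next
  case equal
  have "((\<lambda>y. (G p y - G p 0) / (y - 0)) \<longlongrightarrow> 0) (at_left 0)"
    by (rule tendsto_eventually) (auto simp: G_def eventually_at_filter)
  moreover have "((\<lambda>y. (G p y - G p 0) / (y - 0)) \<longlongrightarrow> 0) (at_right 0)"
  proof -
    \<comment> \<open>The division by \<open>y\<close> in the difference quotient is one more factor
      s = 1/y, hence the polynomial \<open>pCons 0 p\<close>.\<close>
    have "((\<lambda>y. poly (pCons 0 p) (inverse y) / exp (inverse y)) \<longlongrightarrow> 0) (at_right (0::real))"
      by (rule filterlim_compose[OF poly_times_exp_tendsto_0 filterlim_inverse_at_top_right])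
    moreover have "\<forall>\<^sub>F y in at_right 0. poly (pCons 0 p) (inverse y) / exp (inverse y) = (G p y - G p 0) / (y - 0)"
      by (auto simp: G_def eventually_at_filter exp_minus field_simps)
    ultimately show ?thesis
      by (rule Lim_transform_eventually)
  qed
  ultimately have "(G p has_real_derivative 0) (at 0)"
    unfolding has_field_derivative_iff by (simp add: filterlim_at_split)
  then show ?thesis using equal by (simp add: G_def)
qed

lemma smooth_ramp: "smooth f \<Longrightarrow> smooth (\<lambda>x. ramp (f x))"
proof -
  define G where "G n t = (if 0 < t then poly (ramp_poly n) (1 / t) * exp (- 1 / t) else (0::real))" for n t
  have "(G n has_real_derivative G (Suc n) t) (at t)" for n t
    using ramp_poly_has_derivative[of "ramp_poly n" t] unfolding G_def ramp_poly.simps .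
  then have "smooth f \<Longrightarrow> smooth (\<lambda>x. G 0 (f x))"
    by (intro smooth_compose[of UNIV G]) auto
  moreover have "G 0 = ramp" by (auto simp: G_def ramp_def)
  ultimately show "smooth f \<Longrightarrow> smooth (\<lambda>x. ramp (f x))" by simp
qed

lemma ramp_has_derivative: "(ramp has_real_derivative ramp_deriv t) (at t)"
proof -
  have r: "(\<lambda>t. if 0 < t then poly 1 (1 / t) * exp (- 1 / t) else 0) = ramp"
    by (auto simp: ramp_def)
  have d: "(if 0 < t then poly ([:0, 0, 1:] * (1 - pderiv 1)) (1 / t) * exp (- 1 / t) else 0) = ramp_deriv t"
    by (simp add: ramp_deriv_def power2_eq_square)
  show ?thesis
    using ramp_poly_has_derivative[of 1 t] unfolding r d .
qed

text \<open>With s = 1/t the upper bound is s^2/2 \<le> exp s. It makes \<open>ramp\<close>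
  Lipschitz and controls the error terms in the comparison inequality.\<close>

lemma ramp_deriv_bounds: "0 \<le> ramp_deriv t" "ramp_deriv t \<le> 2"
proof -
  show "0 \<le> ramp_deriv t" by (simp add: ramp_deriv_def)
  have "exp (- 1 / t) / t\<^sup>2 \<le> 2" if "0 < t"
  proof -
    have "1 + 1 / t + (1 / t)\<^sup>2 / 2 \<le> exp (1 / t)"
      using that by (intro exp_lower_Taylor_quadratic) simp
    then have "(1 / t)\<^sup>2 / 2 \<le> exp (1 / t)"
      using that by (smt (verit) divide_pos_pos)
    then have "1 / t\<^sup>2 \<le> 2 * exp (1 / t)"
      by (simp add: power_divide)
    then show ?thesis
      using that by (simp add: exp_minus field_simps)
  qed
  then show "ramp_deriv t \<le> 2" by (simp add: ramp_deriv_def)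
qed

lemma ramp_pos: "0 < t \<Longrightarrow> 0 < ramp t"
  and ramp_eq_0: "t \<le> 0 \<Longrightarrow> ramp t = 0"
  and ramp_nonneg: "0 \<le> ramp t"
  and ramp_le_1: "ramp t \<le> 1"
  by (auto simp: ramp_def)

lemma ramp_lipschitz: "\<bar>ramp s - ramp t\<bar> \<le> 2 * \<bar>s - t\<bar>"
proof -
  have "norm (ramp s - ramp t) \<le> 2 * norm (s - t)"
    by (rule field_differentiable_bound[of UNIV ramp ramp_deriv])
       (use ramp_deriv_bounds in \<open>auto simp: ramp_has_derivative abs_le_iff intro: order_trans[of _ 0]\<close>)
  then show ?thesis by simp
qed

lemma ramp_continuous: "continuous_on S ramp"
  by (meson DERIV_isCont continuous_at_imp_continuous_on ramp_has_derivative)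

subsection \<open>Test functions\<close>

text \<open>Any compact subset of \<Omega> off which the function vanishes will do, so the closed
  support need not be computed.\<close>

lemma test_functionsI:
  assumes "smooth \<phi>" "compact K" "K \<subseteq> \<Omega>" "\<And>x. x \<notin> K \<Longrightarrow> \<phi> x = 0"
  shows "\<phi> \<in> test_functions \<Omega>"
proof -
  have "closure (support_on UNIV \<phi>) \<subseteq> K"
    by (rule closure_minimal) (use assms in \<open>auto simp: support_on_def compact_imp_closed\<close>)
  moreover have "compact (closure (support_on UNIV \<phi>))"
    using assms(2) calculation compact_closure bounded_subset closure_subset compact_imp_bounded by meson
  ultimately show ?thesis
    using assms unfolding test_functions_def smooth_def by blast
qed

lemma test_functionsE:
  assumes "\<phi> \<in> test_functions \<Omega>"
  obtains K where "smooth \<phi>" "compact K" "K \<subseteq> \<Omega>" "\<And>x. x \<notin> K \<Longrightarrow> \<phi> x = 0"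
proof
  show "smooth \<phi>" "compact (closure (support_on UNIV \<phi>))" "closure (support_on UNIV \<phi>) \<subseteq> \<Omega>"
    using assms unfolding test_functions_def smooth_def by auto
  show "\<phi> x = 0" if "x \<notin> closure (support_on UNIV \<phi>)" for x
    using that closure_subset[of "support_on UNIV \<phi>"] by (auto simp: support_on_def)
qed

lemma test_functions_smooth: "\<phi> \<in> test_functions \<Omega> \<Longrightarrow> smooth \<phi>"
  by (auto elim: test_functionsE)

lemma partial_zero_outside:
  assumes "compact K" "\<And>x. x \<notin> K \<Longrightarrow> f x = 0" "x \<notin> K"
  shows "partial b f x = 0"
proof -
  have "(f has_derivative (\<lambda>_. 0)) (at x)"
    by (rule has_derivative_transform_within_open[OF has_derivative_const[of 0], of "- K"])
       (use assms in \<open>auto intro: compact_imp_closed\<close>)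
  then show ?thesis
    using frechet_derivative_at by metis
qed

lemma test_functions_partial:
  assumes "\<phi> \<in> test_functions \<Omega>" "b \<in> Basis"
  shows "partial b \<phi> \<in> test_functions \<Omega>"
  using assms(1)
proof (rule test_functionsE)
  fix K assume K: "smooth \<phi>" "compact K" "K \<subseteq> \<Omega>" "\<And>x. x \<notin> K \<Longrightarrow> \<phi> x = 0"
  show ?thesis
    by (rule test_functionsI[of _ K])
       (use K(1-3) assms(2) partial_zero_outside[OF K(2,4)] in \<open>auto intro: smooth_partial\<close>)
qed

subsection \<open>Integration by parts\<close>

lemma integrable_lborel_compact_support:
  fixes f :: "'a::euclidean_space \<Rightarrow> real"
  assumes "continuous_on UNIV f" "compact K" "\<And>x. x \<notin> K \<Longrightarrow> f x = 0"
  shows "integrable lborel f"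
proof -
  have eq: "(\<lambda>x. indicator K x *\<^sub>R f x) = f"
    using assms(3) by (intro ext) (auto simp: indicator_def)
  show ?thesis
    using borel_integrable_compact[OF assms(2) continuous_on_subset[OF assms(1) subset_UNIV]] unfolding eq .
qed

lemma compact_support_bounded:
  fixes f :: "'a::euclidean_space \<Rightarrow> real"
  assumes "continuous_on UNIV f" "compact K" "\<And>x. x \<notin> K \<Longrightarrow> f x = 0"
  obtains B where "\<And>x. \<bar>f x\<bar> \<le> B"
proof -
  have "bounded (f ` K)"
    by (intro compact_imp_bounded compact_continuous_image assms(2) continuous_on_subset[OF assms(1)]) simp
  then obtain B where B: "\<And>x. x \<in> K \<Longrightarrow> \<bar>f x\<bar> \<le> B" "B > 0"
    unfolding bounded_pos by auto
  have "\<bar>f x\<bar> \<le> B" for x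
    using B assms(3) by (cases "x \<in> K") (auto simp: less_imp_le)
  then show thesis using that by blast
qed

lemma smooth_deriv_along_line:
  assumes "smooth f"
  shows "((\<lambda>t. f (x + t *\<^sub>R b)) has_real_derivative partial b f (x + t *\<^sub>R b)) (at t)"
proof -
  interpret linear "frechet_derivative f (at (x + t *\<^sub>R b))"
    using smooth_has_derivative[OF assms] has_derivative_linear by blast
  have "((\<lambda>t. x + t *\<^sub>R b) has_derivative (\<lambda>h. h *\<^sub>R b)) (at t)"
    by (auto intro!: derivative_eq_intros)
  from has_derivative_compose[OF this smooth_has_derivative[OF assms]]
  show ?thesis
    unfolding has_field_derivative_def by (simp add: scale mult_commute_abs)
qed

text \<open>Translation invariance makes the integral of every difference quotient zero, and
  dominated convergence carries this over to the derivative.\<close>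

lemma integral_partial_eq_0:
  fixes f :: "'a::euclidean_space \<Rightarrow> real"
  assumes f: "smooth f" and K: "compact K" "\<And>x. x \<notin> K \<Longrightarrow> f x = 0" and b: "b \<in> Basis"
  shows "(LINT x|lborel. partial b f x) = 0"
proof -
  have cont: "continuous_on UNIV f" "continuous_on UNIV (partial b f)"
    using f b by (auto intro: smooth_continuous smooth_partial)
  have [measurable]: "f \<in> borel_measurable borel" "partial b f \<in> borel_measurable borel"
    using cont by (auto intro: borel_measurable_continuous_onI)
  have "partial b f x = 0" if "x \<notin> K" for x
    by (rule partial_zero_outside[OF K that])
  then obtain B where B: "\<And>x. \<bar>partial b f x\<bar> \<le> B"
    using compact_support_bounded[OF cont(2) K(1)] by blast
  obtain r where r: "\<And>x. x \<in> K \<Longrightarrow> norm x \<le> r"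
    using compact_imp_bounded[OF K(1)] unfolding bounded_iff by blast
  define t where "t n = inverse (real (Suc n))" for n
  have t: "0 < t n" "t n \<le> 1" for n
    by (auto simp: t_def field_simps)
  have t0: "t \<longlonglongrightarrow> 0"
    unfolding t_def by (rule LIMSEQ_inverse_real_of_nat)
  define s where "s n x = (f (x + t n *\<^sub>R b) - f x) / t n" for n x
  have lim: "(\<lambda>n. LINT x|lborel. s n x) \<longlonglongrightarrow> (LINT x|lborel. partial b f x)"
  \<comment> \<open>All steps \<open>t n\<close> are at most 1, so the quotients vanish outside the
    ball of radius \<open>r + 1\<close>; inside, the mean value inequality bounds them by
    \<open>B\<close>.\<close>
  proof (rule integral_dominated_convergence[where w="\<lambda>x. B * indicator (cball 0 (r + 1)) x"])
    show "integrable lborel (\<lambda>x. B * indicator (cball (0::'a) (r + 1)) x)"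
      using emeasure_lborel_cball_finite[of "0::'a" "r + 1"]
      by (intro integrable_mult_right integrable_real_indicator) (auto simp: top.not_eq_extremum)
    show "AE x in lborel. (\<lambda>n. s n x) \<longlonglongrightarrow> partial b f x"
    proof (rule AE_I2)
      fix x
      have "((\<lambda>h. (f (x + h *\<^sub>R b) - f x) / h) \<longlongrightarrow> partial b f x) (at 0)"
        using smooth_deriv_along_line[OF f, of x b 0] unfolding has_field_derivative_iff by simp
      moreover have "filterlim t (at 0) sequentially"
        using t0 t by (auto simp: filterlim_at intro!: always_eventually less_imp_neq[THEN not_sym])
      ultimately show "(\<lambda>n. s n x) \<longlonglongrightarrow> partial b f x"
        unfolding s_def by (rule filterlim_compose)
    qed
    show "AE x in lborel. norm (s n x) \<le> B * indicator (cball 0 (r + 1)) x" for n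
    proof (rule AE_I2)
      fix x
      show "norm (s n x) \<le> B * indicator (cball 0 (r + 1)) x"
      proof (cases "x \<in> cball 0 (r + 1)")
        case True
        have "norm (f (x + t n *\<^sub>R b) - f (x + 0 *\<^sub>R b)) \<le> B * norm (t n - 0)"
          by (rule field_differentiable_bound[of UNIV "\<lambda>t. f (x + t *\<^sub>R b)" "\<lambda>t. partial b f (x + t *\<^sub>R b)"])
             (use smooth_deriv_along_line[OF f] B in auto)
        then show ?thesis
          using True t[of n] by (simp add: s_def field_simps)
      next
        case False
        have "norm (x + t n *\<^sub>R b) \<ge> norm x - norm (t n *\<^sub>R b)"
          using norm_diff_ineq by blast
        then have "x \<notin> K" "x + t n *\<^sub>R b \<notin> K"
          using False r[of x] r[of "x + t n *\<^sub>R b"] t[of n] b by auto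
        then show ?thesis
          using False K by (simp add: s_def)
      qed
    qed
  qed (auto simp: s_def)
  have "(LINT x|lborel. s n x) = 0" for n
  proof -
    have *: "(LINT x|lborel. f (t n *\<^sub>R b + x)) = (LINT x|lborel. f x)"
      using integral_distr[of "(+) (t n *\<^sub>R b)" lborel borel f] by (simp add: lborel_distr_plus)
    have int: "integrable lborel f"
      using integrable_lborel_compact_support[OF cont(1) K] .
    then have "integrable (distr lborel borel ((+) (t n *\<^sub>R b))) f"
      by (simp add: lborel_distr_plus)
    then have "integrable lborel (\<lambda>x. f (t n *\<^sub>R b + x))"
      by (subst (asm) integrable_distr_eq) auto
    then show ?thesis
      using int * by (simp add: s_def add.commute)
  qed
  then have "(\<lambda>n. LINT x|lborel. s n x) \<longlonglongrightarrow> 0" by simp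
  then show ?thesis
    using lim by (rule LIMSEQ_unique[symmetric])
qed

lemma integral_lebesgue_on_eq_lborel:
  fixes g :: "'a::euclidean_space \<Rightarrow> real"
  assumes "\<Omega> \<in> sets lebesgue" "g \<in> borel_measurable borel" "\<And>x. x \<notin> \<Omega> \<Longrightarrow> g x = 0"
  shows "integral\<^sup>L (lebesgue_on \<Omega>) g = integral\<^sup>L lborel g"
proof -
  have eq: "(\<lambda>x. if x \<in> \<Omega> then g x else 0) = g"
    using assms(3) by (intro ext) auto
  have "integral\<^sup>L (lebesgue_on \<Omega>) g = integral\<^sup>L lebesgue g"
    using Lebesgue_Measure.integral_restrict_UNIV[OF assms(1), of g] unfolding eq by (rule sym)
  also have "\<dots> = integral\<^sup>L lborel g"
    using assms(2) by (intro integral_completion) auto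
  finally show ?thesis .
qed

lemma partial_mult:
  assumes "smooth f" "smooth g"
  shows "partial b (\<lambda>x. f x * g x) x = f x * partial b g x + partial b f x * g x"
  using partial_unique[OF has_derivative_mult[OF smooth_has_derivative[OF assms(1)] smooth_has_derivative[OF assms(2)]], of b]
  by (rule fun_cong)

text \<open>Only \<phi> needs compact support: the product \<open>w * \<phi>\<close> inherits it,
  and its derivative integrates to zero.\<close>

lemma integral_by_parts:
  fixes w \<phi> :: "'a::euclidean_space \<Rightarrow> real"
  assumes \<Omega>: "open \<Omega>" and w: "smooth w" and \<phi>: "\<phi> \<in> test_functions \<Omega>" and b: "b \<in> Basis"
  shows "(LINT x|lebesgue_on \<Omega>. w x * partial b \<phi> x) = - (LINT x|lebesgue_on \<Omega>. partial b w x * \<phi> x)"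
proof -
  have leb: "\<Omega> \<in> sets lebesgue" using \<Omega> by simp
  obtain K where K: "smooth \<phi>" "compact K" "K \<subseteq> \<Omega>" "\<And>x. x \<notin> K \<Longrightarrow> \<phi> x = 0"
    using \<phi> test_functionsE by blast
  have K': "partial b \<phi> x = 0" if "x \<notin> K" for x
    by (rule partial_zero_outside[OF K(2,4) that])
  have zero: "w x * partial b \<phi> x = 0" "partial b w x * \<phi> x = 0" if "x \<notin> \<Omega>" for x
    using K(3,4) K' that by auto
  have cont: "continuous_on UNIV (\<lambda>x. w x * partial b \<phi> x)" "continuous_on UNIV (\<lambda>x. partial b w x * \<phi> x)"
    by (intro continuous_intros smooth_continuous w K(1) smooth_partial b)+
  have int: "integrable lborel (\<lambda>x. w x * partial b \<phi> x)" "integrable lborel (\<lambda>x. partial b w x * \<phi> x)"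
    by (rule integrable_lborel_compact_support[OF _ K(2)]; use cont K K' in simp)+
  have "(LINT x|lborel. partial b (\<lambda>x. w x * \<phi> x) x) = 0"
    by (rule integral_partial_eq_0[OF _ K(2) _ b]) (use w K in \<open>auto intro: smooth_mult\<close>)
  then have "(LINT x|lborel. w x * partial b \<phi> x) + (LINT x|lborel. partial b w x * \<phi> x) = 0"
    using int by (simp add: partial_mult[OF w K(1)])
  moreover have "(LINT x|lebesgue_on \<Omega>. w x * partial b \<phi> x) = (LINT x|lborel. w x * partial b \<phi> x)"
    by (rule integral_lebesgue_on_eq_lborel[OF leb]) (use cont zero in \<open>auto intro: borel_measurable_continuous_onI\<close>)
  moreover have "(LINT x|lebesgue_on \<Omega>. partial b w x * \<phi> x) = (LINT x|lborel. partial b w x * \<phi> x)"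
    by (rule integral_lebesgue_on_eq_lborel[OF leb]) (use cont zero in \<open>auto intro: borel_measurable_continuous_onI\<close>)
  ultimately show ?thesis by simp
qed

subsection \<open>The fundamental lemma of the calculus of variations\<close>

text \<open>As \<open>n\<close> grows, these functions converge pointwise to the indicator of
  \<open>box c d\<close>, staying between 0 and 1.\<close>

definition box_bump :: "nat \<Rightarrow> 'a::euclidean_space \<Rightarrow> 'a \<Rightarrow> 'a \<Rightarrow> real" where
  "box_bump n c d x = (\<Prod>b\<in>Basis. ramp (real n * (x \<bullet> b - c \<bullet> b)) * ramp (real n * (d \<bullet> b - x \<bullet> b)))"

lemma smooth_box_bump: "smooth (box_bump n c d)"
  unfolding box_bump_def
  by (intro smooth_prod smooth_mult smooth_ramp smooth_diff smooth_inner smooth_const)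

lemma box_bump_outside:
  assumes "x \<notin> box c d"
  shows "box_bump n c d x = 0"
proof -
  from assms obtain b where b: "b \<in> Basis" "x \<bullet> b \<le> c \<bullet> b \<or> d \<bullet> b \<le> x \<bullet> b"
    by (auto simp: mem_box not_less)
  then have "ramp (real n * (x \<bullet> b - c \<bullet> b)) * ramp (real n * (d \<bullet> b - x \<bullet> b)) = 0"
    by (auto intro!: ramp_eq_0 mult_nonneg_nonpos)
  then show ?thesis
    unfolding box_bump_def using b(1) by (intro prod_zero) auto
qed

lemma box_bump_bounds: "0 \<le> box_bump n c d x" "box_bump n c d x \<le> 1"
  unfolding box_bump_def
  by (auto intro!: prod_nonneg prod_le_1 mult_nonneg_nonneg mult_le_one ramp_nonneg ramp_le_1)

lemma ramp_tendsto_1: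
  assumes "0 < t"
  shows "(\<lambda>n. ramp (real n * t)) \<longlonglongrightarrow> 1"
proof -
  have "(\<lambda>n. exp (- (1 / t) * (1 / real n))) \<longlonglongrightarrow> exp (- (1 / t) * 0)"
    by (intro tendsto_intros lim_1_over_n)
  moreover have "\<forall>\<^sub>F n in sequentially. exp (- (1 / t) * (1 / real n)) = ramp (real n * t)"
    using eventually_gt_at_top[of 0] by eventually_elim (use assms in \<open>simp add: ramp_def mult.commute\<close>)
  ultimately show ?thesis
    using Lim_transform_eventually by fastforce
qed

lemma box_bump_tendsto:
  "(\<lambda>n. box_bump n c d x) \<longlonglongrightarrow> (if x \<in> box c d then 1 else 0)"
proof (cases "x \<in> box c d")
  case True
  have "(\<lambda>n. box_bump n c d x) \<longlonglongrightarrow> (\<Prod>b\<in>(Basis::'a set). 1 * 1)"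
    unfolding box_bump_def
    by (intro tendsto_intros ramp_tendsto_1) (use True in \<open>auto simp: mem_box\<close>)
  then show ?thesis using True by simp
qed (simp add: box_bump_outside)

lemma small_cbox_subset:
  fixes x :: "'a::euclidean_space"
  assumes "open \<Omega>" "x \<in> \<Omega>"
  obtains e where "0 < e" "\<And>h. 0 < h \<Longrightarrow> h < e \<Longrightarrow> cbox x (x + h *\<^sub>R One) \<subseteq> \<Omega>"
proof -
  obtain r where r: "r > 0" "ball x r \<subseteq> \<Omega>"
    using assms open_contains_ball by blast
  show thesis
  proof
    show "0 < r / DIM('a)" using r by simp
    fix h :: real assume h: "0 < h" "h < r / DIM('a)"
    have "cbox x (x + h *\<^sub>R One) \<subseteq> ball x r"
    proof
      fix y assume y: "y \<in> cbox x (x + h *\<^sub>R One)"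
      have "norm (y - x) \<le> (\<Sum>b\<in>Basis. \<bar>(y - x) \<bullet> b\<bar>)"
        by (rule norm_le_l1)
      also have "\<dots> \<le> (\<Sum>b\<in>(Basis::'a set). h)"
        by (rule sum_mono) (use y in \<open>auto simp: mem_box inner_diff_left inner_add_left\<close>)
      also have "\<dots> < r"
        using h by (simp add: field_simps)
      finally show "y \<in> ball x r"
        by (simp add: dist_norm norm_minus_commute)
    qed
    then show "cbox x (x + h *\<^sub>R One) \<subseteq> \<Omega>" using r by blast
  qed
qed

text \<open>Testing with box bumps shows that the integral over every box in \<Omega> vanishes;
  Lebesgue differentiation along shrinking cubes then gives \<open>f x = 0\<close> at almost every
  point.\<close>

lemma AE_zero_if_orthogonal_to_test_functions:
  fixes f :: "'a::euclidean_space \<Rightarrow> real"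
  assumes \<Omega>: "open \<Omega>" and f: "integrable (lebesgue_on \<Omega>) f"
    and orth: "\<And>\<phi>. \<phi> \<in> test_functions \<Omega> \<Longrightarrow> (LINT x|lebesgue_on \<Omega>. f x * \<phi> x) = 0"
  shows "AE x in lebesgue_on \<Omega>. f x = 0"
proof -
  have leb: "\<Omega> \<in> sets lebesgue" using \<Omega> by simp
  have [measurable]: "f \<in> borel_measurable (lebesgue_on \<Omega>)" using f by simp
  define F where "F x = (if x \<in> \<Omega> then f x else 0)" for x
  have F: "integrable lebesgue F"
    unfolding F_def using f by (simp add: Lebesgue_Measure.integrable_restrict_UNIV leb)
  have boxes: "integral (cbox c d) F = 0" if cd: "cbox c d \<subseteq> \<Omega>" for c d
  proof -
    have sub: "box c d \<subseteq> \<Omega>" using cd box_subset_cbox by blast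
    have "(\<lambda>n. LINT x|lebesgue_on \<Omega>. f x * box_bump n c d x) \<longlonglongrightarrow>
          (LINT x|lebesgue_on \<Omega>. f x * (if x \<in> box c d then 1 else 0))"
    proof (rule integral_dominated_convergence[where w="\<lambda>x. norm (f x)"])
      have [measurable]: "box_bump n c d \<in> borel_measurable (lebesgue_on \<Omega>)" for n
        by (rule continuous_imp_measurable_on_sets_lebesgue[OF smooth_continuous[OF smooth_box_bump] leb])
      show "(\<lambda>x. f x * box_bump n c d x) \<in> borel_measurable (lebesgue_on \<Omega>)" for n
        by measurable
      show "(\<lambda>x. f x * (if x \<in> box c d then 1 else 0)) \<in> borel_measurable (lebesgue_on \<Omega>)"
        by (intro borel_measurable_times measurable_If_set) (auto simp: sets_restrict_space_iff leb)
      show "AE x in lebesgue_on \<Omega>. (\<lambda>n. f x * box_bump n c d x) \<longlonglongrightarrow> f x * (if x \<in> box c d then 1 else 0)"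
        by (intro AE_I2 tendsto_mult_left box_bump_tendsto)
      show "AE x in lebesgue_on \<Omega>. norm (f x * box_bump n c d x) \<le> norm (f x)" for n
        using box_bump_bounds[of n c d] by (intro AE_I2) (simp add: abs_mult mult_left_le)
    qed (use f in auto)
    moreover have "(LINT x|lebesgue_on \<Omega>. f x * box_bump n c d x) = 0" for n
      by (intro orth test_functionsI[OF smooth_box_bump compact_cbox cd])
         (use box_bump_outside box_subset_cbox in blast)
    ultimately have "0 = (LINT x|lebesgue_on \<Omega>. f x * (if x \<in> box c d then 1 else 0))"
      by (simp add: LIMSEQ_const_iff)
    also have "\<dots> = (LINT x|lebesgue_on \<Omega>. (if x \<in> box c d then F x else 0))"
      by (rule Bochner_Integration.integral_cong) (auto simp: F_def)
    also have "\<dots> = (LINT x|lebesgue_on (box c d). F x)"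
      by (rule integral_restrict[OF sub]) (use leb in auto)
    also have "\<dots> = integral (box c d) F"
    proof (rule lebesgue_integral_eq_integral)
      have "integrable lebesgue (\<lambda>x. indicator (box c d) x *\<^sub>R F x)"
        by (rule integrable_mult_indicator[OF _ F]) auto
      then show "integrable (lebesgue_on (box c d)) F"
        by (subst integrable_restrict_space) auto
    qed auto
    also have "\<dots> = integral (cbox c d) F"
      by (rule integral_open_interval)
    finally show ?thesis by simp
  qed
  have "F integrable_on cbox c d" for c d
    using F integrable_on_lebesgue integrable_on_subcbox by blast
  \<comment> \<open>This is Lebesgue differentiation for cubes having \<open>x\<close> as a corner;
    such cubes eventually lie in \<Omega>, where the averages are all zero.\<close>
  then obtain N where N: "negligible N"
    "\<And>x e. \<lbrakk>x \<notin> N; 0 < e\<rbrakk> \<Longrightarrow> \<exists>d>0. \<forall>h. 0 < h \<and> h < d \<longrightarrow>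
         norm (integral (cbox x (x + h *\<^sub>R One)) F /\<^sub>R h ^ DIM('a) - F x) < e"
    using integrable_ccontinuous_explicit by metis
  have "f x = 0" if x: "x \<in> \<Omega>" "x \<notin> N" for x
  proof (rule ccontr)
    assume "f x \<noteq> 0"
    then have "0 < \<bar>F x\<bar>" using x by (simp add: F_def)
    with N(2) x obtain d where d: "d > 0"
      "\<And>h. 0 < h \<Longrightarrow> h < d \<Longrightarrow> norm (integral (cbox x (x + h *\<^sub>R One)) F /\<^sub>R h ^ DIM('a) - F x) < \<bar>F x\<bar>"
      by metis
    obtain e where e: "0 < e" "\<And>h. 0 < h \<Longrightarrow> h < e \<Longrightarrow> cbox x (x + h *\<^sub>R One) \<subseteq> \<Omega>"
      using small_cbox_subset[OF \<Omega> x(1)] by blast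
    define h where "h = min d e / 2"
    have "0 < h" "h < d" "h < e" using d e by (auto simp: h_def)
    then show False
      using d(2)[of h] boxes[OF e(2)[of h]] by simp
  qed
  moreover have "AE x in lebesgue. x \<notin> N"
    using N(1) negligible_iff_null_sets AE_not_in by blast
  ultimately show ?thesis
    using leb by (subst AE_restrict_space_iff) auto
qed

subsection \<open>Square integrable functions\<close>

lemma sq_integrableD:
  assumes "sq_integrable \<Omega> f"
  shows "f \<in> borel_measurable (lebesgue_on \<Omega>)" "integrable (lebesgue_on \<Omega>) (\<lambda>x. (norm (f x))\<^sup>2)"
  using assms by (auto simp: sq_integrable_def)

lemma inner_le_half_squares: "\<bar>x \<bullet> y\<bar> \<le> (norm x)\<^sup>2 + (norm y)\<^sup>2"
proof -
  have "\<bar>x \<bullet> y\<bar> \<le> norm x * norm y" by (rule Cauchy_Schwarz_ineq2)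
  also have "\<dots> \<le> (norm x)\<^sup>2 + (norm y)\<^sup>2"
    using sum_squares_bound[of "norm x" "norm y"] mult_nonneg_nonneg[OF norm_ge_zero[of x] norm_ge_zero[of y]]
    by linarith
  finally show ?thesis .
qed

lemma sq_integrable_inner:
  assumes "sq_integrable \<Omega> f" "sq_integrable \<Omega> g"
  shows "integrable (lebesgue_on \<Omega>) (\<lambda>x. f x \<bullet> g x)"
proof (rule Bochner_Integration.integrable_bound)
  note [measurable] = sq_integrableD(1)[OF assms(1)] sq_integrableD(1)[OF assms(2)]
  show "integrable (lebesgue_on \<Omega>) (\<lambda>x. (norm (f x))\<^sup>2 + (norm (g x))\<^sup>2)"
    by (intro Bochner_Integration.integrable_add sq_integrableD assms)
  show "(\<lambda>x. f x \<bullet> g x) \<in> borel_measurable (lebesgue_on \<Omega>)"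
    by measurable
  show "AE x in lebesgue_on \<Omega>. norm (f x \<bullet> g x) \<le> norm ((norm (f x))\<^sup>2 + (norm (g x))\<^sup>2)"
    using inner_le_half_squares by (intro AE_I2) simp
qed

lemma sq_integrable_add:
  assumes "sq_integrable \<Omega> f" "sq_integrable \<Omega> g"
  shows "sq_integrable \<Omega> (\<lambda>x. f x + g x)"
  unfolding sq_integrable_def
proof
  note [measurable] = sq_integrableD(1)[OF assms(1)] sq_integrableD(1)[OF assms(2)]
  show "(\<lambda>x. f x + g x) \<in> borel_measurable (lebesgue_on \<Omega>)"
    by measurable
  have "(\<lambda>x. (norm (f x + g x))\<^sup>2) = (\<lambda>x. (norm (f x))\<^sup>2 + 2 * (f x \<bullet> g x) + (norm (g x))\<^sup>2)"
    by (auto simp: power2_norm_eq_inner inner_add_left inner_add_right inner_commute)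
  then show "integrable (lebesgue_on \<Omega>) (\<lambda>x. (norm (f x + g x))\<^sup>2)"
    using assms by (simp add: sq_integrableD sq_integrable_inner)
qed

lemma sq_integrable_scaleR:
  assumes "sq_integrable \<Omega> f"
  shows "sq_integrable \<Omega> (\<lambda>x. c *\<^sub>R f x)"
  using assms by (auto simp: sq_integrable_def power_mult_distrib)

lemma sq_integrable_diff:
  assumes "sq_integrable \<Omega> f" "sq_integrable \<Omega> g"
  shows "sq_integrable \<Omega> (\<lambda>x. f x - g x)"
  using sq_integrable_add[OF assms(1) sq_integrable_scaleR[OF assms(2), of "-1"]] by simp

lemma integrable_AE_bounded:
  assumes "open \<Omega>" "bounded \<Omega>" "f \<in> borel_measurable (lebesgue_on \<Omega>)"
    and "AE x in lebesgue_on \<Omega>. norm (f x) \<le> B"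
  shows "integrable (lebesgue_on \<Omega>) (f :: _ \<Rightarrow> 'b::{banach, second_countable_topology})"
proof -
  interpret finite_measure "lebesgue_on \<Omega>"
    using assms by (intro finite_measure_lebesgue_on lmeasurable_open)
  show ?thesis using assms(3,4) by (rule integrable_const_bound[rotated])
qed

lemma sq_integrable_AE_bounded:
  assumes "open \<Omega>" "bounded \<Omega>" "f \<in> borel_measurable (lebesgue_on \<Omega>)"
    and "AE x in lebesgue_on \<Omega>. norm (f x) \<le> B"
  shows "sq_integrable \<Omega> f"
  unfolding sq_integrable_def
proof
  show "integrable (lebesgue_on \<Omega>) (\<lambda>x. (norm (f x))\<^sup>2)"
  proof (rule integrable_AE_bounded)
    show "AE x in lebesgue_on \<Omega>. norm ((norm (f x))\<^sup>2) \<le> B\<^sup>2"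
      using assms(4) by eventually_elim (simp add: power_mono)
  qed (use assms in \<open>auto intro!: borel_measurable_power borel_measurable_norm\<close>)
qed (use assms in auto)

lemma sq_integrable_continuous:
  assumes "open \<Omega>" "bounded \<Omega>" "continuous_on (closure \<Omega>) f"
  shows "sq_integrable \<Omega> f"
proof -
  have "bounded (f ` closure \<Omega>)"
    using assms by (intro compact_imp_bounded compact_continuous_image) (auto simp: compact_closure)
  then obtain B where "\<And>x. x \<in> closure \<Omega> \<Longrightarrow> norm (f x) \<le> B"
    unfolding bounded_iff by auto
  then have "AE x in lebesgue_on \<Omega>. norm (f x) \<le> B"
    using closure_subset by (intro AE_I2) auto
  moreover have "f \<in> borel_measurable (lebesgue_on \<Omega>)"
    using assms closure_subset
    by (intro continuous_imp_measurable_on_sets_lebesgue) (auto intro: continuous_on_subset)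
  ultimately show ?thesis
    using sq_integrable_AE_bounded assms by blast
qed

text \<open>Young's inequality replaces the Cauchy-Schwarz inequality for integrals.\<close>

lemma integral_product_tendsto_0:
  fixes f :: "'a::euclidean_space \<Rightarrow> 'b::euclidean_space"
  assumes f: "sq_integrable \<Omega> f" and g: "\<And>n. sq_integrable \<Omega> (g n)"
    and lim: "(\<lambda>n. LINT x|lebesgue_on \<Omega>. (norm (g n x))\<^sup>2) \<longlonglongrightarrow> 0"
  shows "(\<lambda>n. LINT x|lebesgue_on \<Omega>. norm (f x) * norm (g n x)) \<longlonglongrightarrow> 0"
proof (rule LIMSEQ_I)
  fix e :: real assume e: "0 < e"
  define F where "F = (LINT x|lebesgue_on \<Omega>. (norm (f x))\<^sup>2)"
  have F: "0 \<le> F" by (simp add: F_def)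
  define c where "c = e / (F + 1)"
  have c: "0 < c" "c * F < e"
    using e F by (auto simp: c_def field_simps)
  \<comment> \<open>The weight \<open>c\<close> is so small that the first Young term
    \<open>c * F\<close> stays below \<open>e\<close>; the second is at most what is left once the
    squared norm of \<open>g n\<close> is below \<open>c * (e - c * F)\<close>.\<close>
  have ce: "0 < c * (e - c * F)" using c by simp
  from LIMSEQ_D[OF lim ce] obtain N where
    N: "\<And>n. n \<ge> N \<Longrightarrow> norm ((LINT x|lebesgue_on \<Omega>. (norm (g n x))\<^sup>2) - 0) < c * (e - c * F)"
    by blast
  have "norm ((LINT x|lebesgue_on \<Omega>. norm (f x) * norm (g n x)) - 0) < e" if n: "n \<ge> N" for n
  proof -
    note [measurable] = sq_integrableD(1)[OF f] sq_integrableD(1)[OF g[of n]]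
    have young: "norm (f x) * norm (g n x) \<le> c * (norm (f x))\<^sup>2 + (norm (g n x))\<^sup>2 / c" for x
    proof -
      have "0 \<le> (c * norm (f x) - norm (g n x))\<^sup>2 + (c * norm (f x))\<^sup>2 + (norm (g n x))\<^sup>2"
        by simp
      then have "c * (norm (f x) * norm (g n x)) \<le> c * (c * (norm (f x))\<^sup>2 + (norm (g n x))\<^sup>2 / c)"
        using c by (simp add: power2_eq_square algebra_simps)
      then show ?thesis using c by simp
    qed
    have int: "integrable (lebesgue_on \<Omega>) (\<lambda>x. c * (norm (f x))\<^sup>2 + (norm (g n x))\<^sup>2 / c)"
      by (intro Bochner_Integration.integrable_add integrable_mult_right integrable_divide sq_integrableD f g)
    have "(LINT x|lebesgue_on \<Omega>. norm (f x) * norm (g n x))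
        \<le> (LINT x|lebesgue_on \<Omega>. c * (norm (f x))\<^sup>2 + (norm (g n x))\<^sup>2 / c)"
      by (rule integral_mono'[OF int]) (use young c(1) in \<open>auto simp: less_imp_le\<close>)
    also have "\<dots> = c * F + (LINT x|lebesgue_on \<Omega>. (norm (g n x))\<^sup>2) / c"
      unfolding F_def using f g by (simp add: sq_integrableD)
    also have "\<dots> < e"
      using N[OF n] c by (simp add: field_simps)
    finally show ?thesis by (simp add: abs_of_nonneg)
  qed
  then show "\<exists>N. \<forall>n\<ge>N. norm ((LINT x|lebesgue_on \<Omega>. norm (f x) * norm (g n x)) - 0) < e"
    by blast
qed

subsection \<open>Weak gradients\<close>

definition grad :: "('a::euclidean_space \<Rightarrow> real) \<Rightarrow> 'a \<Rightarrow> 'a" where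
  "grad f x = (\<Sum>b\<in>Basis. partial b f x *\<^sub>R b)"

definition laplacian :: "('a::euclidean_space \<Rightarrow> real) \<Rightarrow> 'a \<Rightarrow> real" where
  "laplacian f x = (\<Sum>b\<in>Basis. partial b (partial b f) x)"

lemma grad_inner_Basis: "b \<in> Basis \<Longrightarrow> grad f x \<bullet> b = partial b f x"
  unfolding grad_def by (simp add: inner_sum_left inner_Basis if_distrib cong: if_cong)

lemma grad_inner: "v \<bullet> grad f x = (\<Sum>b\<in>Basis. (v \<bullet> b) * partial b f x)"
  by (simp add: grad_def inner_sum_right mult.commute)

lemma continuous_grad: "smooth f \<Longrightarrow> continuous_on S (grad f)"
  unfolding grad_def by (intro continuous_intros smooth_continuous smooth_partial)

lemma continuous_laplacian: "smooth f \<Longrightarrow> continuous_on S (laplacian f)"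
  unfolding laplacian_def by (intro continuous_intros smooth_continuous smooth_partial)

context
  fixes \<Omega> :: "'a::euclidean_space set"
  assumes \<Omega>: "open \<Omega>" "bounded \<Omega>"
begin

lemma sq_integrable_smooth: "smooth f \<Longrightarrow> sq_integrable \<Omega> f"
  and sq_integrable_grad: "smooth f \<Longrightarrow> sq_integrable \<Omega> (grad f)"
  and sq_integrable_laplacian: "smooth f \<Longrightarrow> sq_integrable \<Omega> (laplacian f)"
  by (auto intro!: sq_integrable_continuous \<Omega> smooth_continuous continuous_grad continuous_laplacian)

lemma sq_integrable_test: "\<phi> \<in> test_functions \<Omega> \<Longrightarrow> sq_integrable \<Omega> \<phi>"
  by (simp add: sq_integrable_smooth test_functions_smooth)

lemma is_weak_gradD:
  assumes "is_weak_grad \<Omega> u G"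
  shows "sq_integrable \<Omega> G"
    and "\<phi> \<in> test_functions \<Omega> \<Longrightarrow> b \<in> Basis \<Longrightarrow>
      (LINT x|lebesgue_on \<Omega>. u x * partial b \<phi> x) = - (LINT x|lebesgue_on \<Omega>. (G x \<bullet> b) * \<phi> x)"
  using assms unfolding is_weak_grad_def by blast+

lemma sq_integrable_component: "sq_integrable \<Omega> G \<Longrightarrow> b \<in> Basis \<Longrightarrow> sq_integrable \<Omega> (\<lambda>x. G x \<bullet> b)"
proof -
  assume G: "sq_integrable \<Omega> G" and b: "b \<in> Basis"
  note [measurable] = sq_integrableD(1)[OF G]
  have "integrable (lebesgue_on \<Omega>) (\<lambda>x. (norm (G x \<bullet> b))\<^sup>2)"
  proof (rule Bochner_Integration.integrable_bound[OF sq_integrableD(2)[OF G]])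
    show "AE x in lebesgue_on \<Omega>. norm ((norm (G x \<bullet> b))\<^sup>2) \<le> norm ((norm (G x))\<^sup>2)"
      using power_mono[OF Basis_le_norm[OF b] abs_ge_zero, of _ 2] by (intro AE_I2) simp
  qed measurable
  then show ?thesis by (auto simp: sq_integrable_def)
qed

lemma integrable_mult_test:
  assumes "sq_integrable \<Omega> (u :: 'a \<Rightarrow> real)" "\<phi> \<in> test_functions \<Omega>"
  shows "integrable (lebesgue_on \<Omega>) (\<lambda>x. u x * \<phi> x)"
  using sq_integrable_inner[OF assms(1) sq_integrable_test[OF assms(2)]] by simp

lemma is_weak_grad_smooth: "smooth w \<Longrightarrow> is_weak_grad \<Omega> w (grad w)"
  unfolding is_weak_grad_def
  using sq_integrable_grad integral_by_parts[OF \<Omega>(1)] by (simp add: grad_inner_Basis)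

lemma is_weak_grad_diff:
  assumes "sq_integrable \<Omega> u" "sq_integrable \<Omega> v" "is_weak_grad \<Omega> u G" "is_weak_grad \<Omega> v H"
  shows "is_weak_grad \<Omega> (\<lambda>x. u x - v x) (\<lambda>x. G x - H x)"
  unfolding is_weak_grad_def
proof (intro conjI ballI)
  show "sq_integrable \<Omega> (\<lambda>x. G x - H x)"
    using assms by (intro sq_integrable_diff is_weak_gradD(1))
  fix \<phi> and b :: 'a assume \<phi>: "\<phi> \<in> test_functions \<Omega>" and b: "b \<in> Basis"
  note p = test_functions_partial[OF \<phi> b]
  have "integrable (lebesgue_on \<Omega>) (\<lambda>x. (G x \<bullet> b) * \<phi> x)" "integrable (lebesgue_on \<Omega>) (\<lambda>x. (H x \<bullet> b) * \<phi> x)"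
    by (intro integrable_mult_test sq_integrable_component is_weak_gradD(1)[OF assms(3)] is_weak_gradD(1)[OF assms(4)] b \<phi>)+
  moreover have "integrable (lebesgue_on \<Omega>) (\<lambda>x. u x * partial b \<phi> x)" "integrable (lebesgue_on \<Omega>) (\<lambda>x. v x * partial b \<phi> x)"
    by (intro integrable_mult_test assms(1,2) p)+
  ultimately show "(LINT x|lebesgue_on \<Omega>. (u x - v x) * partial b \<phi> x)
      = - (LINT x|lebesgue_on \<Omega>. ((G x - H x) \<bullet> b) * \<phi> x)"
    using is_weak_gradD(2)[OF assms(3) \<phi> b] is_weak_gradD(2)[OF assms(4) \<phi> b]
    by (simp add: left_diff_distrib inner_diff_left)
qed

text \<open>The fundamental lemma applied to each component of the difference. It allows the
  representative chosen by \<open>weak_grad\<close> to be exchanged for any explicit weak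
  gradient.\<close>

lemma weak_grad_unique:
  assumes "is_weak_grad \<Omega> u G" "is_weak_grad \<Omega> u H"
  shows "AE x in lebesgue_on \<Omega>. G x = H x"
proof -
  have GH: "sq_integrable \<Omega> G" "sq_integrable \<Omega> H"
    using assms is_weak_gradD(1) by blast+
  have "AE x in lebesgue_on \<Omega>. (G x - H x) \<bullet> b = 0" if b: "b \<in> Basis" for b
  proof (rule AE_zero_if_orthogonal_to_test_functions[OF \<Omega>(1)])
    have "sq_integrable \<Omega> (\<lambda>x. (G x - H x) \<bullet> b)"
      by (intro sq_integrable_component sq_integrable_diff GH b)
    \<comment> \<open>Since \<Omega> is bounded, the constant 1 is square integrable, and pairing
      with it gives integrability.\<close>
    from sq_integrable_inner[OF this sq_integrable_smooth[OF smooth_const[of 1]]]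
    show "integrable (lebesgue_on \<Omega>) (\<lambda>x. (G x - H x) \<bullet> b)" by simp
    fix \<phi> assume \<phi>: "\<phi> \<in> test_functions \<Omega>"
    have "integrable (lebesgue_on \<Omega>) (\<lambda>x. (G x \<bullet> b) * \<phi> x)" "integrable (lebesgue_on \<Omega>) (\<lambda>x. (H x \<bullet> b) * \<phi> x)"
      by (intro integrable_mult_test sq_integrable_component GH b \<phi>)+
    then show "(LINT x|lebesgue_on \<Omega>. ((G x - H x) \<bullet> b) * \<phi> x) = 0"
      using is_weak_gradD(2)[OF assms(1) \<phi> b] is_weak_gradD(2)[OF assms(2) \<phi> b]
      by (simp add: left_diff_distrib inner_diff_left)
  qed
  then have "AE x in lebesgue_on \<Omega>. \<forall>b\<in>Basis. (G x - H x) \<bullet> b = 0"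
    by (intro AE_finite_allI) auto
  then show ?thesis
    by eventually_elim (rule euclidean_eqI, simp add: inner_diff_left)
qed

lemma H1D:
  assumes "u \<in> H1 \<Omega>"
  shows "sq_integrable \<Omega> u" "is_weak_grad \<Omega> u (weak_grad \<Omega> u)"
  using assms someI_ex[of "is_weak_grad \<Omega> u"] unfolding H1_def weak_grad_def by auto

lemma weak_grad_smooth:
  assumes "smooth w"
  shows "AE x in lebesgue_on \<Omega>. weak_grad \<Omega> w x = grad w x"
proof -
  have "w \<in> H1 \<Omega>"
    using assms is_weak_grad_smooth sq_integrable_smooth unfolding H1_def by blast
  then show ?thesis
    using weak_grad_unique[OF H1D(2) is_weak_grad_smooth[OF assms]] by blast
qed

lemma test_functions_H10:
  assumes "\<phi> \<in> test_functions \<Omega>"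
  shows "\<phi> \<in> H10 \<Omega>"
proof -
  have "\<phi> \<in> H1 \<Omega>"
    using is_weak_grad_smooth sq_integrable_test test_functions_smooth assms unfolding H1_def by blast
  \<comment> \<open>The constant sequence approximates \<phi>. What remains is that the
    representative \<open>weak_grad\<close> chosen for the zero function vanishes almost
    everywhere.\<close>
  moreover have "H1_norm \<Omega> (\<lambda>x. \<phi> x - \<phi> x) = 0"
  proof -
    have "grad (\<lambda>x::'a. 0) x = 0" for x
      using partial_unique[OF has_derivative_const, of _ "0::real"] by (simp add: grad_def fun_eq_iff)
    then have "AE x in lebesgue_on \<Omega>. weak_grad \<Omega> (\<lambda>x. 0) x = 0"
      using weak_grad_smooth[OF smooth_const[of 0]] by simp
    then have "AE x in lebesgue_on \<Omega>. 0\<^sup>2 + (norm (weak_grad \<Omega> (\<lambda>x. 0) x))\<^sup>2 = 0"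
      by eventually_elim simp
    then show ?thesis
      unfolding H1_norm_def by (simp add: integral_eq_zero_AE)
  qed
  ultimately show ?thesis
    using assms unfolding H10_def by (intro CollectI conjI exI[of _ "\<lambda>_. \<phi>"]) auto
qed

text \<open>The squared norm splits into two nonnegative parts, which tend to zero separately. By
  uniqueness, the gradient chosen for \<phi> n - u is replaced by the difference of the
  gradients.\<close>

lemma H10_approximation:
  assumes u: "u \<in> H10 \<Omega>"
  obtains \<phi> where "\<And>n. \<phi> n \<in> test_functions \<Omega>"
    and "(\<lambda>n. LINT x|lebesgue_on \<Omega>. (norm (\<phi> n x - u x))\<^sup>2) \<longlonglongrightarrow> 0"
    and "(\<lambda>n. LINT x|lebesgue_on \<Omega>. (norm (grad (\<phi> n) x - weak_grad \<Omega> u x))\<^sup>2) \<longlonglongrightarrow> 0"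
proof -
  obtain \<phi> where \<phi>: "\<And>n. \<phi> n \<in> test_functions \<Omega>"
    and lim: "(\<lambda>n. H1_norm \<Omega> (\<lambda>x. \<phi> n x - u x)) \<longlonglongrightarrow> 0"
    using u unfolding H10_def by blast
  have uH1: "u \<in> H1 \<Omega>" using u by (simp add: H10_def)
  define d where "d n = (LINT x|lebesgue_on \<Omega>. (norm (\<phi> n x - u x))\<^sup>2)" for n
  define D where "D n = (LINT x|lebesgue_on \<Omega>. (norm (grad (\<phi> n) x - weak_grad \<Omega> u x))\<^sup>2)" for n
  have "(H1_norm \<Omega> (\<lambda>x. \<phi> n x - u x))\<^sup>2 = d n + D n" for n
  proof -
    let ?v = "\<lambda>x. \<phi> n x - u x" and ?G = "\<lambda>x. grad (\<phi> n) x - weak_grad \<Omega> u x"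
    have sm: "smooth (\<phi> n)" using \<phi> test_functions_smooth by blast
    have v: "sq_integrable \<Omega> ?v"
      by (intro sq_integrable_diff sq_integrable_smooth sm H1D uH1)
    have G: "is_weak_grad \<Omega> ?v ?G"
      by (intro is_weak_grad_diff sq_integrable_smooth sm H1D uH1 is_weak_grad_smooth)
    have "?v \<in> H1 \<Omega>" using v G unfolding H1_def by blast
    then have W: "is_weak_grad \<Omega> ?v (weak_grad \<Omega> ?v)" by (rule H1D)
    note [measurable] = sq_integrableD(1)[OF v] sq_integrableD(1)[OF is_weak_gradD(1)[OF G]]
      sq_integrableD(1)[OF is_weak_gradD(1)[OF W]]
    have "(LINT x|lebesgue_on \<Omega>. (?v x)\<^sup>2 + (norm (weak_grad \<Omega> ?v x))\<^sup>2)
        = (LINT x|lebesgue_on \<Omega>. (?v x)\<^sup>2 + (norm (?G x))\<^sup>2)"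
    proof (rule integral_cong_AE)
      show "AE x in lebesgue_on \<Omega>. (?v x)\<^sup>2 + (norm (weak_grad \<Omega> ?v x))\<^sup>2 = (?v x)\<^sup>2 + (norm (?G x))\<^sup>2"
        using weak_grad_unique[OF W G] by eventually_elim simp
    qed measurable
    also have "\<dots> = d n + D n"
      unfolding d_def D_def using sq_integrableD(2)[OF v] sq_integrableD(2)[OF is_weak_gradD(1)[OF G]] by simp
    finally show ?thesis
      unfolding H1_norm_def by (simp add: d_def D_def)
  qed
  moreover have "(\<lambda>n. (H1_norm \<Omega> (\<lambda>x. \<phi> n x - u x))\<^sup>2) \<longlonglongrightarrow> 0"
    using tendsto_power[OF lim, of 2] by simp
  ultimately have sum: "(\<lambda>n. d n + D n) \<longlonglongrightarrow> 0" by simp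
  have nonneg: "0 \<le> d n" "0 \<le> D n" for n by (auto simp: d_def D_def)
  have "d \<longlonglongrightarrow> 0"
    by (rule real_tendsto_sandwich[OF _ _ tendsto_const sum]) (use nonneg in auto)
  moreover have "D \<longlonglongrightarrow> 0"
    by (rule real_tendsto_sandwich[OF _ _ tendsto_const sum]) (use nonneg in auto)
  ultimately show thesis
    using that \<phi> unfolding d_def D_def by blast
qed

text \<open>Green's formula; the compact support of \<psi> removes the boundary term.\<close>

lemma integral_grad_inner_grad:
  assumes "smooth w" "\<psi> \<in> test_functions \<Omega>"
  shows "(LINT x|lebesgue_on \<Omega>. grad w x \<bullet> grad \<psi> x) = - (LINT x|lebesgue_on \<Omega>. laplacian w x * \<psi> x)"
proof -
  have sm: "smooth (partial b w)" if "b \<in> Basis" for b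
    using assms(1) that by (rule smooth_partial)
  have "(LINT x|lebesgue_on \<Omega>. grad w x \<bullet> grad \<psi> x)
      = (LINT x|lebesgue_on \<Omega>. (\<Sum>b\<in>Basis. partial b w x * partial b \<psi> x))"
    by (rule Bochner_Integration.integral_cong) (auto simp: grad_inner grad_inner_Basis)
  also have "\<dots> = (\<Sum>b\<in>Basis. (LINT x|lebesgue_on \<Omega>. partial b w x * partial b \<psi> x))"
    by (intro Bochner_Integration.integral_sum integrable_mult_test sq_integrable_smooth sm test_functions_partial assms(2))
  also have "\<dots> = (\<Sum>b\<in>Basis. - (LINT x|lebesgue_on \<Omega>. partial b (partial b w) x * \<psi> x))"
    by (intro sum.cong refl integral_by_parts \<Omega>(1) sm assms(2))
  also have "\<dots> = - (LINT x|lebesgue_on \<Omega>. (\<Sum>b\<in>Basis. partial b (partial b w) x * \<psi> x))"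
    unfolding sum_negf
    by (subst Bochner_Integration.integral_sum) (auto intro!: integrable_mult_test sq_integrable_smooth sm smooth_partial assms(2))
  finally show ?thesis
    by (simp add: laplacian_def sum_distrib_right)
qed

subsection \<open>Comparison with smooth functions\<close>

lemma grad_ramp:
  assumes "smooth \<phi>" "smooth w"
  shows "grad (\<lambda>x. ramp (s * (\<phi> x - w x))) x
    = (s * ramp_deriv (s * (\<phi> x - w x))) *\<^sub>R (grad \<phi> x - grad w x)"
proof -
  have "((\<lambda>x. s * (\<phi> x - w x)) has_derivative (\<lambda>h. s * (partial h \<phi> x - partial h w x))) (at x)" for x
    by (intro has_derivative_mult_right has_derivative_diff smooth_has_derivative assms)
  moreover have "(ramp has_derivative (*) (ramp_deriv t)) (at t)" for t
    using ramp_has_derivative unfolding has_field_derivative_def .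
  ultimately have "((\<lambda>x. ramp (s * (\<phi> x - w x))) has_derivative
      (\<lambda>h. ramp_deriv (s * (\<phi> x - w x)) * (s * (partial h \<phi> x - partial h w x)))) (at x)" for x
    by (rule has_derivative_compose)
  note partial_unique[OF this]
  then have "partial b (\<lambda>x. ramp (s * (\<phi> x - w x))) x
      = ramp_deriv (s * (\<phi> x - w x)) * (s * (partial b \<phi> x - partial b w x))" for b
    by (simp add: fun_eq_iff)
  then show ?thesis
    by - (rule euclidean_eqI, simp add: grad_inner_Basis inner_diff_left)
qed

text \<open>Off the support of \<phi> the argument of \<open>ramp\<close> is \<open>- s * w\<close>,
  which is nonpositive outside \<open>K\<close>. Positive barriers from above can take
  \<open>K\<close> empty; the barrier from below takes a closed ball.\<close>

lemma ramp_test_function: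
  assumes \<phi>: "\<phi> \<in> test_functions \<Omega>" and w: "smooth w" and K: "compact K" "K \<subseteq> \<Omega>"
    and pos: "\<And>x. x \<notin> K \<Longrightarrow> 0 \<le> s * w x"
  shows "(\<lambda>x. ramp (s * (\<phi> x - w x))) \<in> test_functions \<Omega>"
  using \<phi>
proof (rule test_functionsE)
  fix L assume L: "smooth \<phi>" "compact L" "L \<subseteq> \<Omega>" "\<And>x. x \<notin> L \<Longrightarrow> \<phi> x = 0"
  show ?thesis
  proof (rule test_functionsI[of _ "K \<union> L"])
    show "smooth (\<lambda>x. ramp (s * (\<phi> x - w x)))"
      by (intro smooth_ramp smooth_mult smooth_diff smooth_const L(1) w)
    show "ramp (s * (\<phi> x - w x)) = 0" if "x \<notin> K \<union> L" for x
      using that pos[of x] L(4)[of x] by (intro ramp_eq_0) (simp add: algebra_simps)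
  qed (use K L in auto)
qed

text \<open>
  Testing with \<open>ramp (s * (\<phi> n - w))\<close>, where the test functions \<open>\<phi> n\<close> approximate \<open>u\<close>,
  gives comparison from above (\<open>s = 1\<close>) and from below (\<open>s = -1\<close>) without any chain rule
  for weak gradients.
\<close>

proposition comparison_inequality:
  fixes f :: "'a \<Rightarrow> real"
  assumes u: "u \<in> H10 \<Omega>" and f: "sq_integrable \<Omega> f"
    and weak: "\<And>\<phi>. \<phi> \<in> test_functions \<Omega> \<Longrightarrow>
      (LINT x|lebesgue_on \<Omega>. weak_grad \<Omega> u x \<bullet> grad \<phi> x) = (LINT x|lebesgue_on \<Omega>. f x * \<phi> x)"
    and w: "smooth w" and s: "s = 1 \<or> s = (- 1 :: real)"
    and K: "compact K" "K \<subseteq> \<Omega>" "\<And>x. x \<notin> K \<Longrightarrow> 0 \<le> s * w x"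
  shows "0 \<le> (LINT x|lebesgue_on \<Omega>. s * (f x + laplacian w x) * ramp (s * (u x - w x)))"
proof -
  obtain \<phi> where \<phi>: "\<And>n. \<phi> n \<in> test_functions \<Omega>"
    and lim: "(\<lambda>n. LINT x|lebesgue_on \<Omega>. (norm (\<phi> n x - u x))\<^sup>2) \<longlonglongrightarrow> 0"
    and lim': "(\<lambda>n. LINT x|lebesgue_on \<Omega>. (norm (grad (\<phi> n) x - weak_grad \<Omega> u x))\<^sup>2) \<longlonglongrightarrow> 0"
    using H10_approximation[OF u] by blast
  have uH1: "u \<in> H1 \<Omega>" using u by (simp add: H10_def)
  define \<psi> where "\<psi> n x = ramp (s * (\<phi> n x - w x))" for n x
  define r where "r x = ramp (s * (u x - w x))" for x
  define g where "g x = f x + laplacian w x" for x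
  define D where "D x = weak_grad \<Omega> u x - grad w x" for x
  define e where "e n x = grad (\<phi> n) x - weak_grad \<Omega> u x" for n x
  have \<psi>: "\<psi> n \<in> test_functions \<Omega>" for n
    using ramp_test_function[OF \<phi> w K] by (simp add: \<psi>_def[abs_def])
  have sm: "smooth (\<phi> n)" "smooth (\<psi> n)" for n
    using \<phi> \<psi> test_functions_smooth by blast+
  have U: "sq_integrable \<Omega> u" "sq_integrable \<Omega> (weak_grad \<Omega> u)"
    using H1D[OF uH1] is_weak_gradD(1) by blast+
  have g: "sq_integrable \<Omega> g"
    unfolding g_def by (intro sq_integrable_add f sq_integrable_laplacian w)
  have D: "sq_integrable \<Omega> D"
    unfolding D_def by (intro sq_integrable_diff U sq_integrable_grad w)
  have e: "sq_integrable \<Omega> (e n)" for n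
    unfolding e_def by (intro sq_integrable_diff U sq_integrable_grad sm)
  have d: "sq_integrable \<Omega> (\<lambda>x. \<phi> n x - u x)" for n
    by (intro sq_integrable_diff U sq_integrable_smooth sm)
  note [measurable] = sq_integrableD(1)[OF U(1)] sq_integrableD(1)[OF g] sq_integrableD(1)[OF D]
    sq_integrableD(1)[OF e] sq_integrableD(1)[OF sq_integrable_smooth[OF w]]
    sq_integrableD(1)[OF sq_integrable_test[OF \<psi>]]
  have [measurable]: "ramp \<in> borel_measurable borel"
    by (intro borel_measurable_continuous_onI ramp_continuous)
  have De: "integrable (lebesgue_on \<Omega>) (\<lambda>x. norm (D x) * norm (e n x))" for n
  proof -
    have "sq_integrable \<Omega> (\<lambda>x. norm (D x))" "sq_integrable \<Omega> (\<lambda>x. norm (e n x))"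
      using D e by (auto simp: sq_integrable_def)
    from sq_integrable_inner[OF this] show ?thesis by simp
  qed
  have gd: "integrable (lebesgue_on \<Omega>) (\<lambda>x. norm (g x) * norm (\<phi> n x - u x))" for n
    using sq_integrable_inner[OF g d[of n]] by (simp add: abs_mult[symmetric])
  have r: "sq_integrable \<Omega> r"
  proof (rule sq_integrable_AE_bounded[OF \<Omega>])
    show "AE x in lebesgue_on \<Omega>. norm (r x) \<le> 1"
      using ramp_nonneg ramp_le_1 by (intro AE_I2) (simp add: r_def)
    show "r \<in> borel_measurable (lebesgue_on \<Omega>)"
      unfolding r_def[abs_def] by measurable
  qed
  have g\<psi>: "integrable (lebesgue_on \<Omega>) (\<lambda>x. g x * \<psi> n x)" for n
    by (rule integrable_mult_test[OF g \<psi>])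
  have gr: "integrable (lebesgue_on \<Omega>) (\<lambda>x. g x * r x)"
    using sq_integrable_inner[OF g r] by simp
  have lower: "- 2 * (LINT x|lebesgue_on \<Omega>. norm (D x) * norm (e n x)) \<le> s * (LINT x|lebesgue_on \<Omega>. g x * \<psi> n x)" for n
  proof -
    \<comment> \<open>The gradient of \<phi> n - w is split into the fixed field \<open>D\<close>,
      the weak gradient of u - w, and the error \<open>e n\<close>, which tends to zero in
      L2.\<close>
    have grad\<psi>: "grad (\<psi> n) x = (s * ramp_deriv (s * (\<phi> n x - w x))) *\<^sub>R (D x + e n x)" for x
      using grad_ramp[OF sm(1) w] by (simp add: \<psi>_def[abs_def] D_def e_def)
    have int: "integrable (lebesgue_on \<Omega>) (\<lambda>x. D x \<bullet> grad (\<psi> n) x)"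
      by (intro sq_integrable_inner D sq_integrable_grad sm)
    have "(LINT x|lebesgue_on \<Omega>. D x \<bullet> grad (\<psi> n) x)
        = (LINT x|lebesgue_on \<Omega>. weak_grad \<Omega> u x \<bullet> grad (\<psi> n) x) - (LINT x|lebesgue_on \<Omega>. grad w x \<bullet> grad (\<psi> n) x)"
      unfolding D_def inner_diff_left
      by (intro Bochner_Integration.integral_diff sq_integrable_inner U sq_integrable_grad sm w)
    also have "\<dots> = (LINT x|lebesgue_on \<Omega>. f x * \<psi> n x) + (LINT x|lebesgue_on \<Omega>. laplacian w x * \<psi> n x)"
      using weak[OF \<psi>] integral_grad_inner_grad[OF w \<psi>] by simp
    also have "\<dots> = (LINT x|lebesgue_on \<Omega>. g x * \<psi> n x)"
      unfolding g_def distrib_right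
      by (intro Bochner_Integration.integral_add[symmetric] integrable_mult_test f sq_integrable_laplacian w \<psi>)
    finally have eq: "(LINT x|lebesgue_on \<Omega>. s * (D x \<bullet> grad (\<psi> n) x)) = s * (LINT x|lebesgue_on \<Omega>. g x * \<psi> n x)"
      by simp
    \<comment> \<open>Since \<open>s * s = 1\<close>, the integrand is \<open>ramp_deriv\<close>
      times |D|^2, which is nonnegative, plus a cross term with \<open>e n\<close>; only the latter
      can be negative.\<close>
    have "- 2 * (norm (D x) * norm (e n x)) \<le> s * (D x \<bullet> grad (\<psi> n) x)" for x
    proof -
      let ?h = "ramp_deriv (s * (\<phi> n x - w x))"
      have "s * (D x \<bullet> grad (\<psi> n) x) = ?h * (D x \<bullet> D x) + ?h * (D x \<bullet> e n x)"
        using s by (auto simp: grad\<psi> inner_add_right algebra_simps)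
      moreover have "0 \<le> ?h * (D x \<bullet> D x)"
        using ramp_deriv_bounds by (intro mult_nonneg_nonneg) auto
      moreover have "\<bar>?h * (D x \<bullet> e n x)\<bar> \<le> 2 * (norm (D x) * norm (e n x))"
        unfolding abs_mult using ramp_deriv_bounds Cauchy_Schwarz_ineq2
        by (intro mult_mono) auto
      ultimately show ?thesis by linarith
    qed
    then have "(LINT x|lebesgue_on \<Omega>. - 2 * (norm (D x) * norm (e n x))) \<le> (LINT x|lebesgue_on \<Omega>. s * (D x \<bullet> grad (\<psi> n) x))"
      by (intro integral_mono integrable_mult_right De int)
    then show ?thesis
      unfolding eq by simp
  qed
  have "(\<lambda>n. - 2 * (LINT x|lebesgue_on \<Omega>. norm (D x) * norm (e n x))) \<longlonglongrightarrow> - 2 * 0"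
    by (intro tendsto_intros integral_product_tendsto_0[OF D e]) (use lim' in \<open>simp add: e_def\<close>)
  moreover have "(\<lambda>n. s * (LINT x|lebesgue_on \<Omega>. g x * \<psi> n x)) \<longlonglongrightarrow> s * (LINT x|lebesgue_on \<Omega>. g x * r x)"
  proof (intro tendsto_intros)
    have z: "(\<lambda>n. 2 * (LINT x|lebesgue_on \<Omega>. norm (g x) * norm (\<phi> n x - u x))) \<longlonglongrightarrow> 0"
      using tendsto_mult_right_zero[OF integral_product_tendsto_0[OF g d lim], of 2] by simp
    \<comment> \<open>The Lipschitz constant 2 of \<open>ramp\<close> and |s| = 1 bound |\<psi> n -
      r| by 2 |\<phi> n - u|, so the L2 convergence of \<phi> n is enough.\<close>
    show "(\<lambda>n. LINT x|lebesgue_on \<Omega>. g x * \<psi> n x) \<longlonglongrightarrow> (LINT x|lebesgue_on \<Omega>. g x * r x)"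
    proof (rule LIM_zero_cancel, rule Lim_null_comparison[OF always_eventually z], rule allI)
      fix n
      have bound: "\<bar>g x * \<psi> n x - g x * r x\<bar> \<le> 2 * (norm (g x) * norm (\<phi> n x - u x))" for x
      proof -
        have "\<bar>\<psi> n x - r x\<bar> \<le> 2 * \<bar>s * (\<phi> n x - w x) - s * (u x - w x)\<bar>"
          unfolding \<psi>_def r_def by (rule ramp_lipschitz)
        also have "\<dots> = 2 * \<bar>\<phi> n x - u x\<bar>"
          using s by auto
        finally show ?thesis
          using mult_left_mono[of "\<bar>\<psi> n x - r x\<bar>" "2 * \<bar>\<phi> n x - u x\<bar>" "\<bar>g x\<bar>"]
          by (simp add: abs_mult[symmetric] right_diff_distrib[symmetric] mult.left_commute)
      qed
      have "norm ((LINT x|lebesgue_on \<Omega>. g x * \<psi> n x) - (LINT x|lebesgue_on \<Omega>. g x * r x))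
          = norm (LINT x|lebesgue_on \<Omega>. g x * \<psi> n x - g x * r x)"
        using g\<psi> gr by simp
      also have "\<dots> \<le> (LINT x|lebesgue_on \<Omega>. 2 * (norm (g x) * norm (\<phi> n x - u x)))"
        by (rule Bochner_Integration.integral_norm_bound_integral) (use g\<psi> gr gd bound in auto)
      finally show "norm ((LINT x|lebesgue_on \<Omega>. g x * \<psi> n x) - (LINT x|lebesgue_on \<Omega>. g x * r x))
          \<le> 2 * (LINT x|lebesgue_on \<Omega>. norm (g x) * norm (\<phi> n x - u x))"
        by simp
    qed
  qed
  ultimately have "- 2 * 0 \<le> s * (LINT x|lebesgue_on \<Omega>. g x * r x)"
    using lower by (intro LIMSEQ_le) auto
  also have "\<dots> = (LINT x|lebesgue_on \<Omega>. s * g x * r x)"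
    by (simp add: mult.assoc)
  finally show ?thesis by (simp add: g_def r_def)
qed

end

subsection \<open>Radial barriers\<close>

lemma laplacian_const: "laplacian (\<lambda>_. c) x = 0"
proof -
  have "partial b (\<lambda>_::'a. c) = (\<lambda>_. 0)" for b and c :: real
    by (rule partial_unique[where f'="\<lambda>_ _. 0"]) simp
  then show ?thesis by (simp add: laplacian_def)
qed

text \<open>Taking the squared distance as radial variable avoids the singularity of the norm at
  \<open>z\<close>; the chain rule then gives the formula in every dimension.\<close>

lemma laplacian_radial:
  fixes z :: "'a::euclidean_space"
  assumes g: "\<And>t. 0 \<le> t \<Longrightarrow> (g has_real_derivative g1 t) (at t)"
    and g1: "\<And>t. 0 \<le> t \<Longrightarrow> (g1 has_real_derivative g2 t) (at t)"
  shows "laplacian (\<lambda>x. g ((norm (x - z))\<^sup>2)) x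
    = 4 * (norm (x - z))\<^sup>2 * g2 ((norm (x - z))\<^sup>2) + 2 * real DIM('a) * g1 ((norm (x - z))\<^sup>2)"
proof -
  let ?t = "\<lambda>x. (norm (x - z))\<^sup>2"
  have dt: "(?t has_derivative (\<lambda>h. 2 * ((x - z) \<bullet> h))) (at x)" for x
    unfolding power2_norm_eq_inner
    by (auto intro!: derivative_eq_intros simp: inner_commute)
  have comp: "((\<lambda>x. k (?t x)) has_derivative (\<lambda>h. k' (?t x) * (2 * ((x - z) \<bullet> h)))) (at x)"
    if "\<And>t. 0 \<le> t \<Longrightarrow> (k has_real_derivative k' t) (at t)" for k k' x
    using has_derivative_compose[OF dt that[of "?t x", unfolded has_field_derivative_def]] by simp
  have p1: "partial b (\<lambda>x. g (?t x)) = (\<lambda>x. g1 (?t x) * (2 * ((x - z) \<bullet> b)))" for b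
    by (rule partial_unique) (rule comp[OF g])
  have p2: "partial b (\<lambda>x. g1 (?t x) * (2 * ((x - z) \<bullet> b))) x
      = 4 * ((x - z) \<bullet> b)\<^sup>2 * g2 (?t x) + 2 * g1 (?t x)" if b: "b \<in> Basis" for b
  proof -
    have "((\<lambda>x. 2 * ((x - z) \<bullet> b)) has_derivative (\<lambda>h. 2 * (h \<bullet> b))) (at y)" for y
      by (auto intro!: derivative_eq_intros)
    from partial_unique[OF has_derivative_mult[OF comp[OF g1] this], of b]
    show ?thesis
      using b by (simp add: fun_eq_iff power2_eq_square algebra_simps)
  qed
  have "(\<Sum>b\<in>Basis. ((x - z) \<bullet> b)\<^sup>2) = ?t x"
    unfolding power2_norm_eq_inner by (subst euclidean_inner) (simp add: power2_eq_square)
  then show ?thesis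
    unfolding laplacian_def p1
    by (simp add: p2 sum.distrib mult.commute[of 4] sum_distrib_right[symmetric] sum_distrib_left[symmetric] mult.assoc)
qed

text \<open>The set where \<open>f\<close> is positive is open, and a nonempty open set is not
  negligible.\<close>

lemma AE_le_imp_le:
  fixes f :: "'a::euclidean_space \<Rightarrow> real"
  assumes \<Omega>: "open \<Omega>" and f: "continuous_on \<Omega> f" and ae: "AE x in lebesgue_on \<Omega>. f x \<le> 0"
    and x: "x \<in> \<Omega>"
  shows "f x \<le> 0"
proof (rule ccontr)
  define S where "S = \<Omega> \<inter> f -` {0<..}"
  assume "\<not> f x \<le> 0"
  then have "x \<in> S" using x by (simp add: S_def)
  have "open S"
    unfolding S_def using continuous_open_preimage[OF f \<Omega>] by simp
  have "AE x in lebesgue. x \<in> \<Omega> \<longrightarrow> f x \<le> 0"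
    using ae \<Omega> by (subst (asm) AE_restrict_space_iff) auto
  then obtain N where N: "N \<in> null_sets lebesgue" "{x. \<not> (x \<in> \<Omega> \<longrightarrow> f x \<le> 0)} \<subseteq> N"
    unfolding eventually_ae_filter by auto
  then have "S \<subseteq> N" by (force simp: S_def)
  then have "negligible S"
    using negligible_subset[of N S] N(1) by (simp add: negligible_iff_null_sets)
  then show False
    using open_not_negligible[OF \<open>open S\<close>] \<open>x \<in> S\<close> by blast
qed

text \<open>At \<open>t = 0\<close> both sides are 0, because \<open>0 powr a = 0\<close> for every
  exponent.\<close>

lemma abs_powr_mult_self: "0 \<le> (t::real) \<Longrightarrow> \<bar>t\<bar> powr (a - 1) * t = t powr a"
  by (cases "t = 0") (auto simp: powr_diff)

section \<open>Bounds, vanishing and positivity for a fixed nonnegative solution\<close>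

context
  fixes \<Omega> :: "'a::euclidean_space set" and m u :: "'a \<Rightarrow> real" and \<alpha> l B :: real
  assumes \<Omega>: "open \<Omega>" "bounded \<Omega>"
    and \<alpha>: "0 < \<alpha>" "\<alpha> < 1"
    and m: "m \<in> borel_measurable (lebesgue_on \<Omega>)" "AE x in lebesgue_on \<Omega>. \<bar>m x\<bar> \<le> B" "0 < B"
    and l: "l < 0"
    and sol: "weak_solution \<Omega> m \<alpha> l u" and u_AE: "AE x in lebesgue_on \<Omega>. 0 \<le> u x"
    and cont: "continuous_on (closure \<Omega>) u"
begin

lemma u_nonneg: "x \<in> \<Omega> \<Longrightarrow> 0 \<le> u x"
  using AE_le_imp_le[OF \<Omega>(1), of "\<lambda>x. - u x" x] cont u_AE
  by (auto intro!: continuous_on_minus continuous_on_subset[OF cont] closure_subset)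

lemma sq_integrable_nonlinearity: "sq_integrable \<Omega> (\<lambda>x. m x * u x powr \<alpha>)"
proof -
  have "bounded (u ` closure \<Omega>)"
    using \<Omega> cont by (intro compact_imp_bounded compact_continuous_image) (auto simp: compact_closure)
  then obtain U where U: "\<And>x. x \<in> closure \<Omega> \<Longrightarrow> norm (u x) \<le> U"
    unfolding bounded_iff by auto
  show ?thesis
  proof (rule sq_integrable_AE_bounded[OF \<Omega>])
    note [measurable] = m(1) sq_integrableD(1)[OF sq_integrable_continuous[OF \<Omega> cont]]
    show "(\<lambda>x. m x * u x powr \<alpha>) \<in> borel_measurable (lebesgue_on \<Omega>)"
      by measurable
    have "AE x in lebesgue_on \<Omega>. x \<in> \<Omega>" by (intro AE_I2) simp
    with m(2) show "AE x in lebesgue_on \<Omega>. norm (m x * u x powr \<alpha>) \<le> B * U powr \<alpha>"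
    proof eventually_elim
      case (elim x)
      then have "u x powr \<alpha> \<le> U powr \<alpha>"
        using U[of x] u_nonneg[of x] closure_subset \<alpha> by (intro powr_mono2) auto
      then show ?case
        using elim m(3) by (simp add: abs_mult) (intro mult_mono, auto)
    qed
  qed
qed

lemma sq_integrable_rhs: "sq_integrable \<Omega> (\<lambda>x. l * u x + m x * u x powr \<alpha>)"
  using sq_integrable_add[OF sq_integrable_scaleR[OF sq_integrable_continuous[OF \<Omega> cont], of l]
      sq_integrable_nonlinearity] by simp

text \<open>Puts the equation in the form used for comparison: classical gradients of test
  functions, and a plain power of \<open>u\<close> since \<open>u\<close> is nonnegative.\<close>

lemma weak_equation:
  assumes \<phi>: "\<phi> \<in> test_functions \<Omega>"
  shows "(LINT x|lebesgue_on \<Omega>. weak_grad \<Omega> u x \<bullet> grad \<phi> x)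
    = (LINT x|lebesgue_on \<Omega>. (l * u x + m x * u x powr \<alpha>) * \<phi> x)"
proof -
  have H: "\<phi> \<in> H10 \<Omega>" "u \<in> H10 \<Omega>"
    using test_functions_H10[OF \<Omega> \<phi>] sol by (auto simp: weak_solution_def)
  then have H1: "\<phi> \<in> H1 \<Omega>" "u \<in> H1 \<Omega>" by (auto simp: H10_def)
  note [measurable] = sq_integrableD(1)[OF is_weak_gradD(1)[OF \<Omega> H1D(2)[OF \<Omega> H1(1)]]]
    sq_integrableD(1)[OF is_weak_gradD(1)[OF \<Omega> H1D(2)[OF \<Omega> H1(2)]]]
    sq_integrableD(1)[OF sq_integrable_grad[OF \<Omega> test_functions_smooth[OF \<phi>]]]
  have "(LINT x|lebesgue_on \<Omega>. weak_grad \<Omega> u x \<bullet> grad \<phi> x)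
      = (LINT x|lebesgue_on \<Omega>. weak_grad \<Omega> u x \<bullet> weak_grad \<Omega> \<phi> x)"
  proof (rule integral_cong_AE)
    show "AE x in lebesgue_on \<Omega>. weak_grad \<Omega> u x \<bullet> grad \<phi> x = weak_grad \<Omega> u x \<bullet> weak_grad \<Omega> \<phi> x"
      using weak_grad_smooth[OF \<Omega> test_functions_smooth[OF \<phi>]] by eventually_elim simp
  qed measurable
  also have "\<dots> = l * (LINT x|lebesgue_on \<Omega>. u x * \<phi> x)
      + (LINT x|lebesgue_on \<Omega>. m x * (\<bar>u x\<bar> powr (\<alpha> - 1) * u x) * \<phi> x)"
    using sol H(1) by (simp add: weak_solution_def)
  also have "(LINT x|lebesgue_on \<Omega>. m x * (\<bar>u x\<bar> powr (\<alpha> - 1) * u x) * \<phi> x)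
      = (LINT x|lebesgue_on \<Omega>. m x * u x powr \<alpha> * \<phi> x)"
    by (rule Bochner_Integration.integral_cong[OF refl])
       (simp only: abs_powr_mult_self u_nonneg space_lebesgue_on)
  also have "l * (LINT x|lebesgue_on \<Omega>. u x * \<phi> x) + (LINT x|lebesgue_on \<Omega>. m x * u x powr \<alpha> * \<phi> x)
      = (LINT x|lebesgue_on \<Omega>. l * (u x * \<phi> x) + m x * u x powr \<alpha> * \<phi> x)"
    using integrable_mult_test[OF \<Omega> sq_integrable_continuous[OF \<Omega> cont] \<phi>]
      integrable_mult_test[OF \<Omega> sq_integrable_nonlinearity \<phi>] by simp
  finally show ?thesis
    by (simp add: distrib_right mult.assoc)
qed

text \<open>By strictness the integrand of the comparison inequality is nonpositive, yet its
  integral is nonnegative; hence it vanishes almost everywhere. As it is negative wherever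
  \<open>s * (u - w)\<close> is positive, that set is null, and by continuity it is empty. The case
  s = 1 bounds \<open>u\<close> from above by \<open>w\<close>, the case s = -1 from below.\<close>

lemma comparison_principle:
  assumes w: "smooth w" and s: "s = 1 \<or> s = (- 1 :: real)"
    and K: "compact K" "K \<subseteq> \<Omega>" "\<And>x. x \<notin> K \<Longrightarrow> 0 \<le> s * w x"
    and strict: "AE x in lebesgue_on \<Omega>. 0 < s * (u x - w x) \<longrightarrow>
      s * (l * u x + m x * u x powr \<alpha> + laplacian w x) < 0"
    and x: "x \<in> \<Omega>"
  shows "s * (u x - w x) \<le> 0"
proof -
  define F where "F x = s * (l * u x + m x * u x powr \<alpha> + laplacian w x)" for x
  define r where "r x = ramp (s * (u x - w x))" for x
  have F: "sq_integrable \<Omega> F"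
    using sq_integrable_scaleR[OF sq_integrable_add[OF sq_integrable_rhs sq_integrable_laplacian[OF \<Omega> w]], of s]
    by (simp add: F_def[abs_def])
  have cont': "continuous_on (closure \<Omega>) (\<lambda>x. s * (u x - w x))"
    by (intro continuous_intros cont smooth_continuous w)
  have r: "sq_integrable \<Omega> r"
    unfolding r_def[abs_def]
    by (intro sq_integrable_continuous[OF \<Omega>] continuous_on_compose2[OF ramp_continuous[of UNIV] cont']) auto
  have int: "integrable (lebesgue_on \<Omega>) (\<lambda>x. F x * r x)"
    using sq_integrable_inner[OF F r] by simp
  have "0 \<le> (LINT x|lebesgue_on \<Omega>. F x * r x)"
    unfolding F_def r_def
    using sol by (intro comparison_inequality[OF \<Omega> _ sq_integrable_rhs weak_equation w s K])
      (auto simp: weak_solution_def)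
  moreover have nonneg: "AE x in lebesgue_on \<Omega>. 0 \<le> - (F x * r x)"
    using strict
  proof eventually_elim
    case (elim x)
    show ?case
      using elim ramp_eq_0[of "s * (u x - w x)"] ramp_pos[of "s * (u x - w x)"]
      unfolding F_def r_def by (cases "0 < s * (u x - w x)") (auto simp: mult_nonpos_nonneg less_imp_le)
  qed
  ultimately have "(LINT x|lebesgue_on \<Omega>. - (F x * r x)) = 0"
    using integral_nonneg_AE[OF nonneg] by simp
  then have "AE x in lebesgue_on \<Omega>. - (F x * r x) = 0"
    using int nonneg by (subst (asm) integral_nonneg_eq_0_iff_AE) auto
  then have "AE x in lebesgue_on \<Omega>. s * (u x - w x) \<le> 0"
    using strict
  proof eventually_elim
    case (elim x)
    show ?case
      using elim ramp_pos[of "s * (u x - w x)"] unfolding F_def r_def by force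
  qed
  then show ?thesis
    using AE_le_imp_le[OF \<Omega>(1) continuous_on_subset[OF cont' closure_subset] _ x] by simp
qed

text \<open>The constant \<open>k\<close> solves |l| k = B k^\<alpha>. Above it the linear
  absorption beats the sublinear source, so \<open>k\<close> is a strict supersolution where u >
  k.\<close>

lemma sup_bound:
  assumes x: "x \<in> \<Omega>"
  shows "u x \<le> (B / \<bar>l\<bar>) powr (1 / (1 - \<alpha>))"
proof -
  define k where "k = (B / \<bar>l\<bar>) powr (1 / (1 - \<alpha>))"
  have k: "0 < k" using m(3) l by (simp add: k_def)
  have k': "k powr (1 - \<alpha>) = B / \<bar>l\<bar>"
    using m(3) l \<alpha> by (simp add: k_def powr_powr)
  have "1 * (u x - k) \<le> 0"
  \<comment> \<open>Since \<open>k\<close> is positive everywhere, the truncation of \<phi> n - k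
    vanishes wherever \<phi> n does, and \<open>K\<close> may be empty.\<close>
  proof (rule comparison_principle[OF smooth_const _ _ _ _ _ x, of 1 "{}"])
    show "AE x in lebesgue_on \<Omega>. 0 < 1 * (u x - k) \<longrightarrow>
        1 * (l * u x + m x * u x powr \<alpha> + laplacian (\<lambda>_. k) x) < 0"
      using m(2)
    proof (eventually_elim, intro impI)
      fix x assume m: "\<bar>m x\<bar> \<le> B" and "0 < 1 * (u x - k)"
      then have ux: "k < u x" "0 < u x" using k by auto
      have "B / \<bar>l\<bar> < u x powr (1 - \<alpha>)"
        unfolding k'[symmetric] using ux k \<alpha> by (intro powr_less_mono2) auto
      then have "B < \<bar>l\<bar> * u x powr (1 - \<alpha>)"
        using l by (simp add: field_simps)
      then have "B * u x powr \<alpha> < \<bar>l\<bar> * u x powr (1 - \<alpha>) * u x powr \<alpha>"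
        using ux by simp
      also have "\<dots> = \<bar>l\<bar> * u x"
        using ux by (simp add: mult.assoc flip: powr_add)
      finally have "B * u x powr \<alpha> < \<bar>l\<bar> * u x" .
      moreover have "m x * u x powr \<alpha> \<le> B * u x powr \<alpha>"
        using m by (intro mult_right_mono) auto
      ultimately show "1 * (l * u x + m x * u x powr \<alpha> + laplacian (\<lambda>_. k) x) < 0"
        using l by (simp add: laplacian_const)
    qed
  qed (use k in auto)
  then show ?thesis by (simp add: k_def)
qed

text \<open>
  For \<open>\<gamma> = 1 / (1 - \<alpha>)\<close> the function \<open>(\<kappa> |x - z|\<^sup>2)\<^sup>\<gamma>\<close> satisfies \<open>\<Delta>w \<le> q w\<^sup>\<alpha>\<close>
  and vanishes at \<open>z\<close>; adding \<open>\<delta>\<close> to \<open>|x - z|\<^sup>2\<close> makes it smooth.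
\<close>

lemma dead_core:
  fixes q R :: real
  defines "\<gamma> \<equiv> 1 / (1 - \<alpha>)"
  defines "\<kappa> \<equiv> q / (\<gamma> * (4 * (\<gamma> - 1) + 2 * DIM('a)))"
  assumes q: "0 < q" and R: "0 < R" "B / \<bar>l\<bar> \<le> \<kappa> * R\<^sup>2"
    and mq: "AE x in lebesgue_on \<Omega>. dist x z < R \<longrightarrow> m x \<le> - q"
    and z: "z \<in> \<Omega>"
  shows "u z = 0"
proof (rule ccontr)
  assume "u z \<noteq> 0"
  then have uz: "0 < u z" using u_nonneg[OF z] by simp
  have \<gamma>: "1 < \<gamma>" using \<alpha> by (simp add: \<gamma>_def field_simps)
  \<comment> \<open>This identity gives w^\<alpha> the power \<gamma> - 1 of the shifted squared
    distance, the one that bounds the Laplacian of \<open>w\<close>; \<kappa> is normalised so that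
    the coefficients match with factor \<open>q\<close>.\<close>
  have \<gamma>\<alpha>: "\<gamma> * \<alpha> = \<gamma> - 1" using \<alpha> by (simp add: \<gamma>_def field_simps)
  have den: "0 < \<gamma> * (4 * (\<gamma> - 1) + 2 * DIM('a))"
    using \<gamma> by (intro mult_pos_pos add_pos_pos) auto
  then have \<kappa>: "0 < \<kappa>" "\<kappa> * (\<gamma> * (4 * (\<gamma> - 1) + 2 * DIM('a))) = q"
    using q by (auto simp: \<kappa>_def)
  \<comment> \<open>Chosen so that \<open>w z = u z / 2\<close>; the comparison u z \<le> w z then
    contradicts u z > 0.\<close>
  define \<delta> where "\<delta> = (u z / 2) powr (1 / \<gamma>) / \<kappa>"
  have \<delta>: "0 < \<delta>" using uz \<kappa> by (simp add: \<delta>_def)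
  define \<rho> where "\<rho> x = (norm (x - z))\<^sup>2 + \<delta>" for x
  have \<rho>: "0 < \<rho> x" for x using \<delta> by (simp add: \<rho>_def add_nonneg_pos)
  define w where "w x = \<kappa> powr \<gamma> * \<rho> x powr \<gamma>" for x
  have w: "smooth w"
    unfolding w_def[abs_def] \<rho>_def
    by (intro smooth_mult smooth_const smooth_powr smooth_add smooth_dist_sq) (use \<delta> in \<open>simp add: add_nonneg_pos\<close>)
  have wpos: "0 < w x" for x using \<kappa> \<rho>[of x] by (simp add: w_def)
  have lap: "laplacian w x \<le> q * w x powr \<alpha>" for x
  proof -
    define g where "g t = \<kappa> powr \<gamma> * (t + \<delta>) powr \<gamma>" for t
    define g1 where "g1 t = \<kappa> powr \<gamma> * (\<gamma> * (t + \<delta>) powr (\<gamma> - 1))" for t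
    define g2 where "g2 t = \<kappa> powr \<gamma> * (\<gamma> * ((\<gamma> - 1) * (t + \<delta>) powr (\<gamma> - 2)))" for t
    have der: "((\<lambda>t. (t + \<delta>) powr a) has_real_derivative a * (t + \<delta>) powr (a - 1)) (at t)" if "0 \<le> t" for t a
    proof -
      have "((\<lambda>t. t + \<delta>) has_real_derivative 1) (at t)" by (auto intro!: derivative_eq_intros)
      from DERIV_chain2[OF has_real_derivative_powr this] show ?thesis using that \<delta> by simp
    qed
    have "laplacian (\<lambda>x. g ((norm (x - z))\<^sup>2)) x
      = 4 * (norm (x - z))\<^sup>2 * g2 ((norm (x - z))\<^sup>2) + 2 * real DIM('a) * g1 ((norm (x - z))\<^sup>2)"
    proof (rule laplacian_radial[of g g1 g2])
      fix t :: real assume t: "0 \<le> t"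
      show "(g has_real_derivative g1 t) (at t)"
        unfolding g_def[abs_def] g1_def by (intro DERIV_cmult der t)
      show "(g1 has_real_derivative g2 t) (at t)"
        unfolding g1_def[abs_def] g2_def using der[OF t, of "\<gamma> - 1"] by (intro DERIV_cmult) simp
    qed
    moreover have "(\<lambda>x. g ((norm (x - z))\<^sup>2)) = w"
      by (simp add: g_def w_def[abs_def] \<rho>_def)
    ultimately have "laplacian w x = 4 * (norm (x - z))\<^sup>2 * g2 ((norm (x - z))\<^sup>2) + 2 * real DIM('a) * g1 ((norm (x - z))\<^sup>2)"
      by simp
    \<comment> \<open>The factor |x - z|^2 is at most \<rho> x, which raises the exponent \<gamma> -
      2 of the second derivative to \<gamma> - 1.\<close>
    also have "\<dots> \<le> 4 * (\<kappa> powr \<gamma> * (\<gamma> * ((\<gamma> - 1) * \<rho> x powr (\<gamma> - 1)))) + 2 * real DIM('a) * g1 ((norm (x - z))\<^sup>2)"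
    proof -
      have "(norm (x - z))\<^sup>2 * \<rho> x powr (\<gamma> - 2) \<le> \<rho> x powr 1 * \<rho> x powr (\<gamma> - 2)"
        using \<rho>[of x] \<delta> by (intro mult_right_mono) (auto simp: \<rho>_def)
      also have "\<dots> = \<rho> x powr (1 + (\<gamma> - 2))"
        by (rule powr_add[symmetric])
      also have "1 + (\<gamma> - 2) = \<gamma> - 1" by simp
      finally have "(\<kappa> powr \<gamma> * (\<gamma> * (\<gamma> - 1))) * ((norm (x - z))\<^sup>2 * \<rho> x powr (\<gamma> - 2))
          \<le> (\<kappa> powr \<gamma> * (\<gamma> * (\<gamma> - 1))) * \<rho> x powr (\<gamma> - 1)"
        using \<gamma> by (intro mult_left_mono) auto
      then show ?thesis
        by (simp add: g2_def \<rho>_def mult_ac)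
    qed
    also have "\<dots> = \<kappa> powr \<gamma> * (\<gamma> * (4 * (\<gamma> - 1) + 2 * DIM('a))) * \<rho> x powr (\<gamma> - 1)"
      by (simp add: g1_def \<rho>_def algebra_simps)
    \<comment> \<open>One factor \<kappa> is split off to turn the dimensional constant into
      \<open>q\<close>.\<close>
    also have "\<kappa> powr \<gamma> = \<kappa> powr (\<gamma> - 1) * \<kappa>"
      using \<kappa> by (simp add: powr_diff)
    also have "\<kappa> powr (\<gamma> - 1) * \<kappa> * (\<gamma> * (4 * (\<gamma> - 1) + 2 * DIM('a))) * \<rho> x powr (\<gamma> - 1)
        = q * (\<kappa> powr (\<gamma> - 1) * \<rho> x powr (\<gamma> - 1))"
      using \<kappa>(2) by (simp add: mult.assoc)
    also have "\<kappa> powr (\<gamma> - 1) * \<rho> x powr (\<gamma> - 1) = w x powr \<alpha>"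
      unfolding w_def using \<kappa> \<rho>[of x] by (simp add: powr_mult powr_powr \<gamma>\<alpha>)
    finally show ?thesis .
  qed
  have "1 * (u z - w z) \<le> 0"
  proof (rule comparison_principle[OF w _ _ _ _ _ z, of 1 "{}"])
    have "AE x in lebesgue_on \<Omega>. x \<in> \<Omega>" by (intro AE_I2) simp
    with mq show "AE x in lebesgue_on \<Omega>. 0 < 1 * (u x - w x) \<longrightarrow>
        1 * (l * u x + m x * u x powr \<alpha> + laplacian w x) < 0"
    proof (eventually_elim, intro impI)
      fix x assume mx: "dist x z < R \<longrightarrow> m x \<le> - q" and x: "x \<in> \<Omega>" and "0 < 1 * (u x - w x)"
      then have ux: "w x < u x" "0 < u x" using wpos[of x] by auto
      \<comment> \<open>Beyond radius \<open>R\<close> the barrier already exceeds the global bound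
        of \<open>sup_bound\<close>, so u > w can occur only where m \<le> -q is known.\<close>
      have "dist x z < R"
      proof (rule ccontr)
        assume "\<not> dist x z < R"
        then have "R\<^sup>2 \<le> (norm (x - z))\<^sup>2"
          using R by (intro power_mono) (auto simp: dist_norm)
        then have "\<kappa> * R\<^sup>2 \<le> \<kappa> * \<rho> x"
          using \<kappa> \<delta> by (intro mult_left_mono) (auto simp: \<rho>_def)
        then have "(B / \<bar>l\<bar>) powr \<gamma> \<le> (\<kappa> * \<rho> x) powr \<gamma>"
          using R m(3) \<gamma> by (intro powr_mono2) auto
        also have "\<dots> = w x"
          using \<kappa> \<rho>[of x] by (simp add: w_def powr_mult)
        finally show False
          using sup_bound[OF x] ux by (simp add: \<gamma>_def)
      qed
      \<comment> \<open>The absorption outweighs the Laplacian of \<open>w\<close>, and the negative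
        linear term \<open>l * u x\<close> supplies strictness.\<close>
      then have "m x * u x powr \<alpha> \<le> - q * u x powr \<alpha>"
        using mx by (intro mult_right_mono) auto
      also have "\<dots> \<le> - q * w x powr \<alpha>"
        using q ux wpos[of x] \<alpha> by (simp add: powr_mono2)
      finally have "m x * u x powr \<alpha> \<le> - q * w x powr \<alpha>" .
      moreover have "l * u x < 0"
        using l ux by (simp add: mult_neg_pos)
      ultimately show "1 * (l * u x + m x * u x powr \<alpha> + laplacian w x) < 0"
        using lap[of x] by simp
    qed
  qed (use wpos in \<open>auto intro: less_imp_le\<close>)
  moreover have "w z = u z / 2"
  proof -
    have "w z = (\<kappa> * \<delta>) powr \<gamma>"
      using \<kappa> \<delta> by (simp add: w_def \<rho>_def powr_mult)
    also have "\<dots> = u z / 2"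
      using \<kappa> \<gamma> uz by (simp add: \<delta>_def powr_powr)
    finally show ?thesis .
  qed
  ultimately show False using uz by simp
qed

text \<open>Hopf's barrier: a multiple of exp(-a |x - z|^2), shifted to vanish on the sphere of
  radius \<open>R\<close>. For large \<open>a\<close> it is a strict subsolution of the linear part
  away from \<open>z\<close>, and near \<open>z\<close> it lies below \<open>u\<close> by
  continuity; so it stays below \<open>u\<close>, and it is positive in the open ball.\<close>

lemma positive_on_ball:
  assumes R: "0 < R" "cball z R \<subseteq> \<Omega>" and mpos: "\<And>x. x \<in> ball z R \<Longrightarrow> 0 \<le> m x"
    and uz: "0 < u z" and x: "x \<in> ball z R"
  shows "0 < u x"
proof -
  \<comment> \<open>By continuity u > \<delta> within some distance \<open>s\<close> of
    \<open>z\<close>, while the barrier stays below \<delta>; so u < v can occur only at distance at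
    least \<open>s\<close>.\<close>
  define \<delta> where "\<delta> = u z / 2"
  have \<delta>: "0 < \<delta>" "\<delta> < u z" using uz by (auto simp: \<delta>_def)
  have zin: "z \<in> \<Omega>" using R by auto
  then have "continuous (at z) u"
    using continuous_on_interior[OF continuous_on_subset[OF cont closure_subset]] \<Omega>(1) by (simp add: interior_open)
  then have "\<forall>\<^sub>F x in nhds z. \<delta> < u x"
    using \<delta>(2) by (auto simp: isCont_def tendsto_at_iff_tendsto_nhds dest: order_tendstoD(1))
  then obtain s where s: "0 < s" "\<And>x. dist x z < s \<Longrightarrow> \<delta> < u x"
    unfolding eventually_nhds_metric by blast
  define N where "N = real DIM('a)"
  have N: "1 \<le> N" by (simp add: N_def Suc_leI)
  \<comment> \<open>At distance at least \<open>s\<close> this makes 4 a^2 |x - z|^2 at least 4 a (N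
    + |l|), which dominates the first-order term 2 a N and the zeroth-order term |l|.\<close>
  define a where "a = 1 + (N + \<bar>l\<bar>) / s\<^sup>2"
  have a: "1 \<le> a" "N + \<bar>l\<bar> \<le> a * s\<^sup>2" using s N by (auto simp: a_def field_simps)
  define g where "g t = \<delta> * (exp (- a * t) - exp (- a * R\<^sup>2))" for t
  define v where "v x = g ((norm (x - z))\<^sup>2)" for x
  have v: "smooth v"
    unfolding v_def[abs_def] g_def
    by (intro smooth_mult smooth_diff smooth_exp smooth_const smooth_dist_sq)
  have lap: "laplacian v x = 4 * (norm (x - z))\<^sup>2 * (\<delta> * (a\<^sup>2 * exp (- a * (norm (x - z))\<^sup>2)))
      + 2 * N * (- \<delta> * (a * exp (- a * (norm (x - z))\<^sup>2)))" for x
    unfolding v_def N_def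
    by (rule laplacian_radial[of g "\<lambda>t. - \<delta> * (a * exp (- a * t))" "\<lambda>t. \<delta> * (a\<^sup>2 * exp (- a * t))"])
       (auto simp: g_def[abs_def] power2_eq_square intro!: derivative_eq_intros)
  \<comment> \<open>Outside the open ball the barrier is nonpositive. This gives the condition off
    \<open>K\<close> for s = -1, and confines u < v to the ball because \<open>u\<close> is
    nonnegative.\<close>
  have out: "v x < 0 \<or> v x = 0" if "R \<le> dist x z" for x
  proof -
    have "R\<^sup>2 \<le> (norm (x - z))\<^sup>2"
      using R that by (intro power_mono) (auto simp: dist_norm)
    then have "exp (- a * (norm (x - z))\<^sup>2) \<le> exp (- a * R\<^sup>2)"
      using a by simp
    then show ?thesis
      using \<delta> mult_nonneg_nonpos[of \<delta> "exp (- a * (norm (x - z))\<^sup>2) - exp (- a * R\<^sup>2)"]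
      by (auto simp: v_def g_def)
  qed
  have "- 1 * (u x - v x) \<le> 0"
  proof (rule comparison_principle[OF v, of "- 1" "cball z R"])
    show "0 \<le> - 1 * v x" if "x \<notin> cball z R" for x
      using out[of x] that by (auto simp: dist_commute)
    show "x \<in> \<Omega>" using x R by auto
    have "AE x in lebesgue_on \<Omega>. x \<in> \<Omega>" by (intro AE_I2) simp
    then show "AE x in lebesgue_on \<Omega>. 0 < - 1 * (u x - v x) \<longrightarrow>
        - 1 * (l * u x + m x * u x powr \<alpha> + laplacian v x) < 0"
    proof (eventually_elim, intro impI)
      fix x assume x: "x \<in> \<Omega>" and "0 < - 1 * (u x - v x)"
      then have ux: "u x < v x" "0 \<le> u x" using u_nonneg by auto
      define E where "E = exp (- a * (norm (x - z))\<^sup>2)"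
      have E: "0 < E" "E \<le> 1" using a by (auto simp: E_def)
      have vE: "v x < \<delta> * E"
        using \<delta> by (simp add: v_def g_def E_def right_diff_distrib)
      also have "\<delta> * E \<le> \<delta>" using \<delta> E by (simp add: mult_left_le)
      finally have "\<not> dist x z < s" using ux s(2)[of x] by auto
      then have "s\<^sup>2 \<le> (norm (x - z))\<^sup>2"
        using s by (intro power_mono) (auto simp: dist_norm)
      then have "a * s\<^sup>2 \<le> a * (norm (x - z))\<^sup>2"
        using a by (intro mult_left_mono) auto
      then have "N + \<bar>l\<bar> \<le> a * (norm (x - z))\<^sup>2"
        using a(2) by linarith
      then have "4 * a * (N + \<bar>l\<bar>) \<le> 4 * a * (a * (norm (x - z))\<^sup>2)"
        using a by (intro mult_left_mono) auto
      moreover have "\<bar>l\<bar> \<le> a * \<bar>l\<bar>" "0 < a * N" "0 \<le> a * \<bar>l\<bar>"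
        using a N mult_right_mono[of 1 a "\<bar>l\<bar>"] by auto
      ultimately have "0 < 4 * a\<^sup>2 * (norm (x - z))\<^sup>2 - 2 * a * N - \<bar>l\<bar>"
        by (simp add: power2_eq_square algebra_simps)
      then have "0 < \<delta> * E * (4 * a\<^sup>2 * (norm (x - z))\<^sup>2 - 2 * a * N - \<bar>l\<bar>)"
        using \<delta> E by simp
      also have "\<dots> = laplacian v x - \<bar>l\<bar> * (\<delta> * E)"
        unfolding lap E_def by (simp add: algebra_simps)
      also have "\<dots> \<le> laplacian v x - \<bar>l\<bar> * u x"
        using ux vE by (intro diff_left_mono mult_left_mono) auto
      finally have "0 < laplacian v x + l * u x" using l by simp
      moreover have "0 \<le> m x * u x powr \<alpha>"
        using out[of x] ux mpos[of x] by (intro mult_nonneg_nonneg) (auto simp: dist_commute not_le[symmetric])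
      ultimately show "- 1 * (l * u x + m x * u x powr \<alpha> + laplacian v x) < 0"
        by simp
    qed
  qed (use R in auto)
  moreover have "0 < v x"
  proof -
    have "(norm (x - z))\<^sup>2 < R\<^sup>2"
      using x R by (intro power_strict_mono) (auto simp: dist_norm norm_minus_commute)
    then show ?thesis using \<delta> a by (simp add: v_def g_def)
  qed
  ultimately show ?thesis by simp
qed

text \<open>Both the positivity set and its complement in \<open>V\<close> are open, the first by
  \<open>positive_on_ball\<close> around its own points, the second because positivity nearby would
  spread to the point. Connectedness leaves only the positivity set.\<close>

lemma strong_maximum_principle:
  assumes V: "open V" "connected V" "V \<subseteq> \<Omega>" and mpos: "\<And>x. x \<in> V \<Longrightarrow> 0 \<le> m x"
    and z: "z \<in> V" "u z \<noteq> 0" and x: "x \<in> V"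
  shows "0 < u x"
proof -
  define P where "P = {x \<in> V. 0 < u x}"
  have "open P"
    unfolding open_contains_ball
  proof
    fix p assume p: "p \<in> P"
    then obtain R where R: "0 < R" "cball p R \<subseteq> V"
      using V open_contains_cball unfolding P_def by blast
    then have "ball p R \<subseteq> P"
      using p positive_on_ball[of R p, OF R(1) order_trans[OF R(2) V(3)] mpos] ball_subset_cball[of p R]
      unfolding P_def by blast
    then show "\<exists>e>0. ball p e \<subseteq> P" using R by blast
  qed
  moreover have "open (V - P)"
    unfolding open_contains_ball
  proof
    fix p assume p: "p \<in> V - P"
    then obtain R where R: "0 < R" "cball p R \<subseteq> V"
      using V open_contains_cball by blast
    \<comment> \<open>For \<open>y\<close> within R/3 of \<open>p\<close>, the closed ball of radius
      R/2 about \<open>y\<close> still lies in \<open>cball p R\<close>, and its interior contains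
      \<open>p\<close>.\<close>
    have "ball p (R / 3) \<subseteq> V - P"
    proof
      fix y assume y: "y \<in> ball p (R / 3)"
      have sub: "cball y (R / 2) \<subseteq> V"
      proof
        fix q assume "q \<in> cball y (R / 2)"
        then have "dist p q \<le> R"
          using y dist_triangle[of p q y] R by auto
        then show "q \<in> V" using R by auto
      qed
      have "y \<notin> P"
      proof
        assume "y \<in> P"
        have b: "ball y (R / 2) \<subseteq> V" "p \<in> ball y (R / 2)"
          using sub ball_subset_cball[of y "R / 2"] y R by (auto simp: dist_commute)
        have "0 < u p"
          by (rule positive_on_ball[of "R / 2" y, OF _ _ mpos[OF subsetD[OF b(1)]] _ b(2)])
             (use R sub V(3) \<open>y \<in> P\<close> in \<open>auto simp: P_def\<close>)
        then show False using p unfolding P_def by auto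
      qed
      moreover have "y \<in> V" using y R by auto
      ultimately show "y \<in> V - P" by blast
    qed
    then show "\<exists>e>0. ball p e \<subseteq> V - P" using R by (intro exI[of _ "R / 3"]) auto
  qed
  ultimately have "P \<inter> V = {} \<or> (V - P) \<inter> V = {}"
    using V(2) by (intro connectedD) auto
  moreover have "z \<in> P"
    using z V(3) u_nonneg[of z] by (auto simp: P_def less_le)
  ultimately show ?thesis using x z(1) by (auto simp: P_def)
qed

end

text \<open>The two Nehari conditions give (1 - \<alpha>) M(u) > 0, whereas M(u) would be
  nonpositive if \<open>u\<close> vanished wherever \<open>m\<close> is positive.\<close>

lemma nehari_plus_nonzero_where_positive:
  assumes u: "u \<in> nehari_plus \<Omega> m \<alpha> l" and \<alpha>: "\<alpha> < 1"
  obtains z where "z \<in> \<Omega>" "0 < m z" "u z \<noteq> 0"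
proof (rule ccontr)
  assume none: "\<not> thesis"
  have "0 < (1 - \<alpha>) * M_form \<Omega> m \<alpha> u"
    using u by (simp add: nehari_plus_def algebra_simps)
  then have "0 < M_form \<Omega> m \<alpha> u"
    using \<alpha> by (simp add: zero_less_mult_iff)
  moreover have "M_form \<Omega> m \<alpha> u \<le> 0"
    unfolding M_form_def
  proof -
    have "0 \<le> (LINT x|lebesgue_on \<Omega>. - (m x * \<bar>u x\<bar> powr (\<alpha> + 1)))"
    proof (rule integral_nonneg_AE, rule AE_I2)
      fix x assume "x \<in> space (lebesgue_on \<Omega>)"
      then have "m x \<le> 0 \<or> u x = 0" using none that[of x] by force
      then show "0 \<le> - (m x * \<bar>u x\<bar> powr (\<alpha> + 1))" by (auto intro: mult_nonpos_nonneg)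
    qed
    then show "(LINT x|lebesgue_on \<Omega>. m x * \<bar>u x\<bar> powr (\<alpha> + 1)) \<le> 0" by simp
  qed
  ultimately show False by simp
qed

subsection \<open>Exterior points near the boundary\<close>

text \<open>The Lipschitz gradient is bounded on the ball, and the mean value inequality applies
  because balls are convex.\<close>

lemma C11_function_lipschitz_on_ball:
  assumes "C11_function g" "0 < r"
  obtains \<Lambda> where "0 \<le> \<Lambda>" "\<And>x y. x \<in> ball a r \<Longrightarrow> y \<in> ball a r \<Longrightarrow> \<bar>g x - g y\<bar> \<le> \<Lambda> * norm (x - y)"
proof -
  obtain G L where g: "\<And>x. (g has_derivative (\<lambda>h. G x \<bullet> h)) (at x)" and G: "L-lipschitz_on UNIV G"
    using assms(1) unfolding C11_function_def by blast
  have L: "0 \<le> L" using G lipschitz_on_nonneg by blast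
  define \<Lambda> where "\<Lambda> = norm (G a) + L * r"
  have G_bound: "norm (G x) \<le> \<Lambda>" if "x \<in> ball a r" for x
  proof -
    have "norm (G x - G a) \<le> L * norm (x - a)"
      using lipschitz_onD[OF G, of x a] by (simp add: dist_norm)
    also have "\<dots> \<le> L * r"
      using that L by (intro mult_left_mono) (auto simp: dist_norm norm_minus_commute)
    finally show ?thesis
      unfolding \<Lambda>_def using norm_triangle_ineq2[of "G x" "G a"] by linarith
  qed
  show thesis
  proof
    show "0 \<le> \<Lambda>" using L assms(2) by (simp add: \<Lambda>_def)
    fix x y assume "x \<in> ball a r" "y \<in> ball a r"
    moreover have "onorm (\<lambda>h. G z \<bullet> h) \<le> \<Lambda>" if "z \<in> ball a r" for z
    proof (rule onorm_le)
      fix h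
      have "norm (G z \<bullet> h) \<le> norm (G z) * norm h"
        using Cauchy_Schwarz_ineq2 by simp
      also have "\<dots> \<le> \<Lambda> * norm h"
        using G_bound[OF that] by (intro mult_right_mono) auto
      finally show "norm (G z \<bullet> h) \<le> \<Lambda> * norm h" .
    qed
    ultimately have "norm (g x - g y) \<le> \<Lambda> * norm (x - y)"
      using g by (intro differentiable_bound[of "ball a r" g "\<lambda>x h. G x \<bullet> h"])
        (auto intro: has_derivative_at_withinI)
    then show "\<bar>g x - g y\<bar> \<le> \<Lambda> * norm (x - y)" by simp
  qed
qed

text \<open>Moving from \<open>b\<close> by \<open>t\<close> straight below the graph gives the
  exterior point. The slope bound \<Lambda> on the graph keeps it at distance at least t / (1 +
  \<Lambda>) from \<open>U\<close>, an exterior cone condition.\<close>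

lemma exterior_points_local:
  fixes U :: "'a::euclidean_space set"
  assumes U: "open U" "C11_boundary U" and p: "p \<in> frontier U"
  obtains e M where "0 < e" "0 < M"
    "\<And>b t. b \<in> frontier U \<Longrightarrow> b \<in> ball p e \<Longrightarrow> 0 < t \<Longrightarrow> t < e \<Longrightarrow>
       \<exists>y. dist b y \<le> t \<and> (\<forall>c\<in>closure U. t \<le> M * dist y c)"
proof -
  obtain r \<nu> g where r: "0 < r" and \<nu>: "norm \<nu> = 1" and g: "C11_function g"
    and graph: "U \<inter> ball p r = {y \<in> ball p r. y \<bullet> \<nu> > g (y - (y \<bullet> \<nu>) *\<^sub>R \<nu>)}"
    using U(2) p unfolding C11_boundary_def by blast
  have \<nu>2: "\<nu> \<bullet> \<nu> = 1" using \<nu> by (simp add: dot_square_norm)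
  define proj where "proj y = y - (y \<bullet> \<nu>) *\<^sub>R \<nu>" for y
  have proj_diff: "proj x - proj y = proj (x - y)" for x y
    by (simp add: proj_def inner_diff_left algebra_simps)
  have "norm (proj x) \<le> norm x" for x
  proof -
    have "(norm (proj x))\<^sup>2 = (norm x)\<^sup>2 - (x \<bullet> \<nu>)\<^sup>2"
      unfolding power2_norm_eq_inner proj_def
      by (simp add: inner_diff_left inner_diff_right \<nu>2 inner_commute power2_eq_square)
    then have "(norm (proj x))\<^sup>2 \<le> (norm x)\<^sup>2" by simp
    then show ?thesis by (rule power2_le_imp_le) simp
  qed
  then have proj_le: "norm (proj x - proj y) \<le> norm (x - y)" for x y
    unfolding proj_diff .
  obtain \<Lambda> where \<Lambda>: "0 \<le> \<Lambda>"
    "\<And>x y. x \<in> ball (proj p) r \<Longrightarrow> y \<in> ball (proj p) r \<Longrightarrow> \<bar>g x - g y\<bar> \<le> \<Lambda> * norm (x - y)"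
    using C11_function_lipschitz_on_ball[OF g r] by blast
  have proj_ball: "proj x \<in> ball (proj p) r" if "x \<in> ball p r" for x
    using that proj_le[of p x] by (simp add: dist_norm)
  have "\<exists>y. dist b y \<le> t \<and> (\<forall>c\<in>closure U. t \<le> (1 + \<Lambda>) * dist y c)"
    if b: "b \<in> frontier U" "b \<in> ball p (r / 8)" and t: "0 < t" "t < r / 8" for b t
  proof (intro exI[of _ "b - t *\<^sub>R \<nu>"] conjI ballI)
    define y where "y = b - t *\<^sub>R \<nu>"
    have bU: "b \<notin> U" "b \<in> ball p r"
      using b U(1) r by (auto simp: frontier_def interior_open)
    then have bg: "b \<bullet> \<nu> \<le> g (proj b)"
      using graph unfolding proj_def by force
    have projy: "proj y = proj b"
      by (simp add: y_def proj_def inner_diff_left \<nu>2 algebra_simps)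
    show byt: "dist b (b - t *\<^sub>R \<nu>) \<le> t"
      using t \<nu> by (simp add: dist_norm)
    have inU: "t \<le> (1 + \<Lambda>) * dist y c" if c: "c \<in> U" for c
    proof (cases "c \<in> ball p r")
      case True
      then have "g (proj c) < c \<bullet> \<nu>"
        using c graph unfolding proj_def by blast
      moreover have "\<bar>g (proj c) - g (proj b)\<bar> \<le> \<Lambda> * norm (c - y)"
      proof -
        have "\<bar>g (proj c) - g (proj b)\<bar> \<le> \<Lambda> * norm (proj c - proj b)"
          by (intro \<Lambda>(2) proj_ball True bU)
        also have "\<dots> \<le> \<Lambda> * norm (c - y)"
          using proj_le[of c y] \<Lambda>(1) projy by (intro mult_left_mono) auto
        finally show ?thesis .
      qed
      moreover have "c \<bullet> \<nu> \<le> y \<bullet> \<nu> + norm (c - y)"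
        using norm_cauchy_schwarz[of "c - y" \<nu>] \<nu> by (simp add: inner_diff_left)
      moreover have "y \<bullet> \<nu> = b \<bullet> \<nu> - t"
        by (simp add: y_def inner_diff_left \<nu>2)
      \<comment> \<open>Chain of heights along \<nu>: \<open>b\<close> is not above the graph, the
        graph over \<open>c\<close> differs by at most \<Lambda> |c - y|, \<open>c\<close> is above
        the graph, and \<open>y\<close> is \<open>t\<close> below \<open>b\<close>.\<close>
      ultimately have "t \<le> norm (c - y) + \<Lambda> * norm (c - y)"
        using bg by linarith
      then show ?thesis
        by (simp add: dist_norm norm_minus_commute distrib_right)
    next
      case False
      \<comment> \<open>Here \<open>c\<close> has distance at least \<open>r\<close> from
        \<open>p\<close>, while \<open>y\<close> lies within r/8 + t < r/4 of \<open>p\<close>; the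
        choice r/8 thus makes \<open>dist y c\<close> exceed \<open>t\<close>.\<close>
      have "dist p c \<le> dist p b + dist b y + dist y c"
        using dist_triangle[of p c b] dist_triangle[of b c y] by linarith
      moreover have "dist b y \<le> t" "dist p b < r / 8" "r \<le> dist p c"
        using byt b(2) False by (auto simp: y_def)
      ultimately have "t \<le> dist y c"
        using t by linarith
      also have "\<dots> \<le> (1 + \<Lambda>) * dist y c"
        using \<Lambda>(1) by (simp add: distrib_right)
      finally show ?thesis .
    qed
    have "closure U \<subseteq> {c. t \<le> (1 + \<Lambda>) * dist y c}"
      using inU by (intro closure_minimal closed_Collect_le continuous_intros) auto
    then show "t \<le> (1 + \<Lambda>) * dist (b - t *\<^sub>R \<nu>) c" if "c \<in> closure U" for c
      using that by (auto simp: y_def)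
  qed
  then show thesis
    using that[of "r / 8" "1 + \<Lambda>"] r \<Lambda>(1) by auto
qed

text \<open>The frontier is compact, so finitely many local neighbourhoods suffice; the smallest
  radius and the largest constant are taken. Inserting 1 covers an empty family and ensures M \<ge>
  1.\<close>

lemma exterior_points_uniform:
  fixes U :: "'a::euclidean_space set"
  assumes U: "open U" "C11_boundary U" "bounded U"
  obtains e M where "0 < e" "1 \<le> M"
    "\<And>b t. b \<in> frontier U \<Longrightarrow> 0 < t \<Longrightarrow> t < e \<Longrightarrow>
       \<exists>y. dist b y \<le> t \<and> (\<forall>c\<in>closure U. t \<le> M * dist y c)"
proof -
  have "\<forall>p. \<exists>e M. p \<in> frontier U \<longrightarrow> 0 < e \<and> 0 < M \<and>
    (\<forall>b\<in>frontier U. \<forall>t. b \<in> ball p e \<longrightarrow> 0 < t \<longrightarrow> t < e \<longrightarrow>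
       (\<exists>y. dist b y \<le> t \<and> (\<forall>c\<in>closure U. t \<le> M * dist y c)))"
    using exterior_points_local[OF U(1,2)] by metis
  then obtain \<epsilon> \<mu> where loc: "\<And>p. p \<in> frontier U \<Longrightarrow> 0 < \<epsilon> p \<and> 0 < \<mu> p \<and>
    (\<forall>b\<in>frontier U. \<forall>t. b \<in> ball p (\<epsilon> p) \<longrightarrow> 0 < t \<longrightarrow> t < \<epsilon> p \<longrightarrow>
       (\<exists>y. dist b y \<le> t \<and> (\<forall>c\<in>closure U. t \<le> \<mu> p * dist y c)))"
    by metis
  have "compact (frontier U)"
    using U(3) by (rule compact_frontier_bounded)
  moreover have "frontier U \<subseteq> (\<Union>p\<in>frontier U. ball p (\<epsilon> p))"
    using loc by auto
  ultimately obtain D where D: "D \<subseteq> frontier U" "finite D" "frontier U \<subseteq> (\<Union>p\<in>D. ball p (\<epsilon> p))"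
    using compactE_image[of "frontier U" "frontier U" "\<lambda>p. ball p (\<epsilon> p)"] by blast
  show thesis
  proof
    show "0 < Min (insert 1 (\<epsilon> ` D))" using D loc by (subst Min_gr_iff) auto
    show "1 \<le> Max (insert 1 (\<mu> ` D))" using D by (intro Max_ge) auto
    fix b t assume b: "b \<in> frontier U" and t: "0 < t" "t < Min (insert 1 (\<epsilon> ` D))"
    obtain p where p: "p \<in> D" "b \<in> ball p (\<epsilon> p)" using b D by blast
    have "t < \<epsilon> p" "\<mu> p \<le> Max (insert 1 (\<mu> ` D))"
      using t p D by auto
    moreover obtain y where "dist b y \<le> t" "\<forall>c\<in>closure U. t \<le> \<mu> p * dist y c"
      using loc[of p] p D b t(1) \<open>t < \<epsilon> p\<close> by blast
    ultimately show "\<exists>y. dist b y \<le> t \<and> (\<forall>c\<in>closure U. t \<le> Max (insert 1 (\<mu> ` D)) * dist y c)"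
      by (meson mult_right_mono order_trans zero_le_dist)
  qed
qed

subsection \<open>Hausdorff distance\<close>

lemma hausdorff_dist_bounds:
  assumes "A \<noteq> {}" "B \<noteq> {}" "\<And>a. a \<in> A \<Longrightarrow> infdist a B \<le> c" "\<And>b. b \<in> B \<Longrightarrow> infdist b A \<le> c"
  shows "hausdorff_dist A B \<le> c" "0 \<le> hausdorff_dist A B"
proof -
  show "hausdorff_dist A B \<le> c"
    unfolding hausdorff_dist_def using assms by (auto intro!: cSUP_least)
  obtain a where "a \<in> A" using assms by blast
  \<comment> \<open>The supremum is one of reals, so the assumed bound is what makes it dominate the
    individual distance.\<close>
  then have "infdist a B \<le> (SUP a\<in>A. infdist a B)"
    using assms(3) by (intro cSUP_upper bdd_aboveI2) auto
  then show "0 \<le> hausdorff_dist A B"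
    unfolding hausdorff_dist_def using infdist_nonneg[of a B] by linarith
qed

lemma hausdorff_dist_neighbourhood:
  assumes "A \<noteq> {}" "A \<subseteq> K" "K \<subseteq> {x. infdist x A \<le> \<rho>}" "0 \<le> \<rho>"
  shows "hausdorff_dist K A \<le> \<rho>" "0 \<le> hausdorff_dist K A"
proof -
  have "infdist b K \<le> \<rho>" if "b \<in> A" for b
    using that assms infdist_zero[of b K] by auto
  then show "hausdorff_dist K A \<le> \<rho>" "0 \<le> hausdorff_dist K A"
    using hausdorff_dist_bounds[of K A \<rho>] assms by blast+
qed

text \<open>Both directions cross a frontier along a segment. A frontier point of \<open>K\<close>
  lies outside \<open>U\<close> but within \<rho> of its closure, so the segment to a nearest point
  meets the frontier of \<open>U\<close>. From a frontier point of \<open>U\<close>, the segment to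
  an exterior point beyond \<open>K\<close> meets the frontier of \<open>K\<close>.\<close>

lemma hausdorff_dist_frontier:
  fixes U K :: "'a::euclidean_space set"
  assumes U: "open U" "bounded U" "U \<noteq> {}" and K: "compact K" "closure U \<subseteq> K"
    "K \<subseteq> {x. infdist x (closure U) \<le> \<rho>}" and \<rho>: "0 < \<rho>" "2 * M * \<rho> < e" and M: "1 \<le> M"
    and ext: "\<And>b t. b \<in> frontier U \<Longrightarrow> 0 < t \<Longrightarrow> t < e \<Longrightarrow>
       \<exists>y. dist b y \<le> t \<and> (\<forall>c\<in>closure U. t \<le> M * dist y c)"
  shows "hausdorff_dist (frontier K) (frontier U) \<le> 2 * M * \<rho>"
    "0 \<le> hausdorff_dist (frontier K) (frontier U)"
proof -
  have ne: "closure U \<noteq> {}" using U by auto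
  have UK: "U \<subseteq> interior K"
    using U(1) K(2) closure_subset[of U] by (intro interior_maximal) auto
  have "frontier U \<noteq> {}"
    using U not_bounded_UNIV by (intro frontier_not_empty) auto
  moreover have "frontier K \<noteq> {}"
    using U K not_bounded_UNIV compact_imp_bounded by (intro frontier_not_empty) auto
  moreover have "infdist a (frontier U) \<le> 2 * M * \<rho>" if a: "a \<in> frontier K" for a
  proof -
    have "a \<in> K" "a \<notin> U"
      using a UK K(1) by (auto simp: frontier_def compact_imp_closed)
    obtain c where c: "c \<in> closure U" "infdist a (closure U) = dist a c"
      using infdist_attains_inf[of "closure U" a] ne by auto
    have "closed_segment a c \<inter> frontier U \<noteq> {}"
    proof (cases "c \<in> U")
      case True
      then show ?thesis
        using \<open>a \<notin> U\<close> by (intro connected_Int_frontier) auto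
    next
      case False
      then show ?thesis using c U(1) by (auto simp: frontier_def interior_open)
    qed
    then obtain q where q: "q \<in> closed_segment a c" "q \<in> frontier U" by blast
    have "infdist a (frontier U) \<le> dist a q"
      using q(2) by (rule infdist_le)
    also have "\<dots> \<le> dist a c"
      using dist_in_closed_segment(1)[OF q(1)] by (simp add: dist_commute)
    also have "\<dots> \<le> \<rho>" using c K(3) \<open>a \<in> K\<close> by auto
    also have "\<dots> \<le> 2 * M * \<rho>" using M \<rho> by simp
    finally show ?thesis .
  qed
  moreover have "infdist b (frontier K) \<le> 2 * M * \<rho>" if b: "b \<in> frontier U" for b
  proof -
    \<comment> \<open>With t = 2 M \<rho> the exterior point has distance at least 2 \<rho> from the
      closure of \<open>U\<close>: the factor \<open>M\<close> offsets the loss in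
      \<open>ext\<close>, and the factor 2 puts the point strictly beyond the \<rho>-neighbourhood
      containing \<open>K\<close>.\<close>
    have "0 < 2 * M * \<rho>" using M \<rho> by simp
    from ext[OF b this \<rho>(2)] obtain y where y: "dist b y \<le> 2 * M * \<rho>"
      and far: "\<And>c. c \<in> closure U \<Longrightarrow> 2 * M * \<rho> \<le> M * dist y c" by blast
    have "y \<notin> K"
    proof
      assume "y \<in> K"
      obtain c where c: "c \<in> closure U" "infdist y (closure U) = dist y c"
        using infdist_attains_inf[of "closure U" y] ne by auto
      have "M * (2 * \<rho>) \<le> M * dist y c" using far[OF c(1)] by (simp add: mult_ac)
      then have "2 * \<rho> \<le> dist y c" using M by simp
      then show False using c K(3) \<open>y \<in> K\<close> \<rho> by auto
    qed
    moreover have "b \<in> K" using b K(2) by (auto simp: frontier_def)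
    ultimately have "closed_segment b y \<inter> frontier K \<noteq> {}"
      by (intro connected_Int_frontier) auto
    then obtain q where q: "q \<in> closed_segment b y" "q \<in> frontier K" by blast
    have "infdist b (frontier K) \<le> dist b q"
      using q(2) by (rule infdist_le)
    also have "\<dots> \<le> dist b y"
      using dist_in_closed_segment(1)[OF q(1)] by (simp add: dist_commute)
    finally show ?thesis using y by linarith
  qed
  ultimately show "hausdorff_dist (frontier K) (frontier U) \<le> 2 * M * \<rho>"
    "0 \<le> hausdorff_dist (frontier K) (frontier U)"
    using hausdorff_dist_bounds[of "frontier K" "frontier U" "2 * M * \<rho>"] by blast+
qed

section \<open>Asymptotics as the parameter tends to minus infinity\<close>

lemma abs_powr_half_tendsto_0: "((\<lambda>l::real. c * \<bar>l\<bar> powr (- 1 / 2)) \<longlongrightarrow> 0) at_bot"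
proof -
  have "filterlim (\<lambda>l::real. \<bar>l\<bar>) at_top at_bot"
    unfolding filterlim_at_top
  proof
    fix Z :: real
    show "\<forall>\<^sub>F l in at_bot. Z \<le> \<bar>l\<bar>"
      using eventually_le_at_bot[of "- Z"] by eventually_elim linarith
  qed
  from tendsto_neg_powr[OF _ this, of "- 1 / 2"]
  show ?thesis by (intro tendsto_mult_right_zero) simp
qed

theorem theorem9:
  fixes \<Omega> Op :: "'a::euclidean_space set"
    and m :: "'a \<Rightarrow> real"
    and u :: "real \<Rightarrow> 'a \<Rightarrow> real"
    and \<alpha> m0 q0 :: real
  assumes alpha: "0 < \<alpha>" "\<alpha> < 1"
    and Omega: "open \<Omega>" "connected \<Omega>" "bounded \<Omega>" "C11_boundary \<Omega>"
    and m_bounded: "ess_bounded \<Omega> m"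
    and Op_def: "Op = {x \<in> \<Omega>. 0 < m x}"
    and Op: "open Op" "connected Op" "Op \<noteq> {}" "closure Op \<subseteq> \<Omega>" "C11_boundary Op"
    and constants_pos: "0 < m0" "0 < q0"
    and m_lower: "AE x in lebesgue_on Op. m0 \<le> m x"
    and m_upper: "AE x in lebesgue_on (\<Omega> - closure Op). m x \<le> - q0"
    and u_min: "\<And>l. l < 0 \<Longrightarrow> nehari_plus_minimizer \<Omega> m \<alpha> l (u l)"
    and u_cont: "\<And>l. l < 0 \<Longrightarrow> continuous_on (closure \<Omega>) (u l)"
  shows "\<exists>C>0.
     (\<forall>\<^sub>F l in at_bot.
        closure Op \<subseteq> supp \<Omega> (u l) \<and>
        supp \<Omega> (u l) \<subseteq> {x \<in> \<Omega>. infdist x (closure Op) < C * \<bar>l\<bar> powr (- 1 / 2)}) \<and>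
     (\<forall>\<^sub>F l in at_bot.
        hausdorff_dist (supp \<Omega> (u l)) (closure Op) \<le> C * \<bar>l\<bar> powr (- 1 / 2)) \<and>
     ((\<lambda>l. hausdorff_dist (supp \<Omega> (u l)) (closure Op)) \<longlongrightarrow> 0) at_bot \<and>
     (\<exists>C'\<ge>C. \<forall>\<^sub>F l in at_bot.
        hausdorff_dist (free_boundary \<Omega> (u l)) (frontier Op) \<le> C' * \<bar>l\<bar> powr (- 1 / 2)) \<and>
     ((\<lambda>l. hausdorff_dist (free_boundary \<Omega> (u l)) (frontier Op)) \<longlongrightarrow> 0) at_bot"
proof -
  obtain B0 where B0: "AE x in lebesgue_on \<Omega>. \<bar>m x\<bar> \<le> B0"
    and m_meas: "m \<in> borel_measurable (lebesgue_on \<Omega>)"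
    using m_bounded unfolding ess_bounded_def by blast
  define B where "B = max B0 1"
  have B: "AE x in lebesgue_on \<Omega>. \<bar>m x\<bar> \<le> B" "0 < B"
    using B0 by (auto simp: B_def elim: eventually_mono)
  define \<gamma> where "\<gamma> = 1 / (1 - \<alpha>)"
  define \<kappa> where "\<kappa> = q0 / (\<gamma> * (4 * (\<gamma> - 1) + 2 * DIM('a)))"
  have "1 < \<gamma>" using alpha by (simp add: \<gamma>_def field_simps)
  then have "0 < \<gamma> * (4 * (\<gamma> - 1) + 2 * DIM('a))"
    by (intro mult_pos_pos add_pos_pos) auto
  then have \<kappa>: "0 < \<kappa>" using constants_pos by (simp add: \<kappa>_def)
  \<comment> \<open>Chosen so that the radius \<open>\<rho> l\<close> satisfies the condition of
    \<open>dead_core\<close> with equality, for \<gamma> and \<kappa> as there with q = q0.\<close>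
  define C0 where "C0 = sqrt (B / \<kappa>)"
  have C0: "0 < C0" "\<kappa> * C0\<^sup>2 = B" using B \<kappa> by (auto simp: C0_def)
  define \<rho> where "\<rho> l = C0 * \<bar>l\<bar> powr (- 1 / 2)" for l
  have \<rho>_pos: "0 < \<rho> l" if "l < 0" for l using C0 that by (simp add: \<rho>_def)
  have \<rho>_sq: "\<kappa> * (\<rho> l)\<^sup>2 = B / \<bar>l\<bar>" if "l < 0" for l
  proof -
    have "(\<bar>l\<bar> powr (- 1 / 2))\<^sup>2 = \<bar>l\<bar> powr (- 1)"
      by (simp add: power2_eq_square flip: powr_add)
    also have "\<dots> = 1 / \<bar>l\<bar>" using that by (simp add: powr_minus divide_inverse)
    finally have "(\<rho> l)\<^sup>2 = C0\<^sup>2 * (1 / \<bar>l\<bar>)" by (simp add: \<rho>_def power_mult_distrib)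
    then have "\<kappa> * (\<rho> l)\<^sup>2 = (\<kappa> * C0\<^sup>2) * (1 / \<bar>l\<bar>)" by simp
    then show ?thesis unfolding C0(2) by simp
  qed
  have \<rho>_lim: "(\<rho> \<longlongrightarrow> 0) at_bot"
    unfolding \<rho>_def by (rule abs_powr_half_tendsto_0)
  have Op_sub: "Op \<subseteq> \<Omega>" using Op_def by blast
  have Op_bdd: "bounded Op" using Omega(3) Op_sub bounded_subset by blast
  have ne: "closure Op \<noteq> {}" using Op(3) by auto
  have "compact (closure Op)" using Op_bdd by (simp add: compact_closure)
  \<comment> \<open>Once \<open>\<rho> l\<close> is at most \<open>d\<close>, the neighbourhood
    containing the support lies in \<Omega> itself and stays away from its boundary.\<close>
  then obtain d where d: "0 < d" "{x. infdist x (closure Op) \<le> d} \<subseteq> \<Omega>"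
    using compact_in_open_separated[OF ne _ Omega(1) Op(4)] by blast
  obtain e M where e: "0 < e" "1 \<le> M"
    and ext: "\<And>b t. b \<in> frontier Op \<Longrightarrow> 0 < t \<Longrightarrow> t < e \<Longrightarrow>
       \<exists>y. dist b y \<le> t \<and> (\<forall>c\<in>closure Op. t \<le> M * dist y c)"
    using exterior_points_uniform[OF Op(1,5) Op_bdd] by blast
  have m_out: "AE x in lebesgue_on \<Omega>. x \<notin> closure Op \<longrightarrow> m x \<le> - q0"
    using m_upper Omega(1) by (auto simp: AE_restrict_space_iff elim: eventually_mono)
  have Op_supp: "closure Op \<subseteq> supp \<Omega> (u l)" if l: "l < 0" for l
  proof -
    have sol: "weak_solution \<Omega> m \<alpha> l (u l)" "AE x in lebesgue_on \<Omega>. 0 \<le> u l x"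
      "u l \<in> nehari_plus \<Omega> m \<alpha> l"
      using u_min[OF l] by (auto simp: nehari_plus_minimizer_def)
    obtain z where z: "z \<in> Op" "u l z \<noteq> 0"
      using nehari_plus_nonzero_where_positive[OF sol(3) alpha(2)] Op_def by auto
    have "0 < u l x" if x: "x \<in> Op" for x
      by (rule strong_maximum_principle[OF Omega(1,3) alpha m_meas B l sol(1,2) u_cont[OF l]
            Op(1,2) Op_sub _ z x]) (use Op_def in auto)
    then have "Op \<subseteq> support_on \<Omega> (u l)"
      using Op_sub by (force simp: support_on_def)
    then show ?thesis unfolding supp_def by (rule closure_mono)
  qed
  have supp_near: "supp \<Omega> (u l) \<subseteq> {x. infdist x (closure Op) \<le> \<rho> l}" if l: "l < 0" for l
    unfolding supp_def
  proof (rule closure_minimal)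
    have sol: "weak_solution \<Omega> m \<alpha> l (u l)" "AE x in lebesgue_on \<Omega>. 0 \<le> u l x"
      using u_min[OF l] by (auto simp: nehari_plus_minimizer_def)
    show "closed {x. infdist x (closure Op) \<le> \<rho> l}"
      by (intro closed_Collect_le continuous_intros)
    show "support_on \<Omega> (u l) \<subseteq> {x. infdist x (closure Op) \<le> \<rho> l}"
    proof
      fix x assume "x \<in> support_on \<Omega> (u l)"
      then have x: "x \<in> \<Omega>" "u l x \<noteq> 0" by (auto simp: support_on_def)
      show "x \<in> {x. infdist x (closure Op) \<le> \<rho> l}"
      proof (rule ccontr)
        assume "x \<notin> {x. infdist x (closure Op) \<le> \<rho> l}"
        then have far: "\<rho> l < infdist x (closure Op)" by simp
        \<comment> \<open>The ball of radius \<open>\<rho> l\<close> about \<open>x\<close> misses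
          the closure of \<open>Op\<close>, so m \<le> -q0 almost everywhere in its part inside
          \<Omega>.\<close>
        have "AE y in lebesgue_on \<Omega>. dist y x < \<rho> l \<longrightarrow> m y \<le> - q0"
          using m_out
        proof eventually_elim
          case (elim y)
          then show ?case
            using far infdist_le[of y "closure Op" x] by (auto simp: dist_commute)
        qed
        then have "u l x = 0"
          using \<rho>_pos[OF l] \<rho>_sq[OF l] x(1)
          by (intro dead_core[OF Omega(1,3) alpha m_meas B l sol u_cont[OF l] constants_pos(2), of "\<rho> l"])
             (auto simp: \<kappa>_def \<gamma>_def)
        then show False using x by simp
      qed
    qed
  qed
  have small: "\<forall>\<^sub>F l in at_bot. l < 0 \<and> \<rho> l \<le> d \<and> 2 * M * \<rho> l < e"
  proof -
    have "((\<lambda>l. 2 * M * \<rho> l) \<longlongrightarrow> 0) at_bot"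
      using tendsto_mult_right_zero[OF \<rho>_lim] .
    then have "\<forall>\<^sub>F l in at_bot. 2 * M * \<rho> l < e"
      using order_tendstoD(2) e(1) by blast
    moreover have "\<forall>\<^sub>F l in at_bot. \<rho> l < d"
      using order_tendstoD(2)[OF \<rho>_lim d(1)] .
    moreover have "\<forall>\<^sub>F l in at_bot. l < (0::real)"
      by (rule eventually_gt_at_bot)
    ultimately show ?thesis by eventually_elim simp
  qed
  \<comment> \<open>Doubling C0 turns the closed estimate of \<open>supp_near\<close> into the
    strict inequality.\<close>
  have incl: "supp \<Omega> (u l) \<subseteq> {x \<in> \<Omega>. infdist x (closure Op) < 2 * C0 * \<bar>l\<bar> powr (- 1 / 2)}"
    if "l < 0" "\<rho> l \<le> d" for l
    using supp_near[OF that(1)] d(2) that(2) \<rho>_pos[OF that(1)] by (force simp: \<rho>_def)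
  have hd: "hausdorff_dist (supp \<Omega> (u l)) (closure Op) \<le> \<rho> l"
    "0 \<le> hausdorff_dist (supp \<Omega> (u l)) (closure Op)" if "l < 0" for l
    using hausdorff_dist_neighbourhood[OF ne Op_supp[OF that] supp_near[OF that]] \<rho>_pos[OF that] by auto
  have hd_frontier: "hausdorff_dist (free_boundary \<Omega> (u l)) (frontier Op) \<le> 2 * M * \<rho> l"
    "0 \<le> hausdorff_dist (free_boundary \<Omega> (u l)) (frontier Op)"
    if "l < 0" "\<rho> l \<le> d" "2 * M * \<rho> l < e" for l
  proof -
    have sub: "supp \<Omega> (u l) \<subseteq> \<Omega>" using incl[OF that(1,2)] by auto
    have cl: "closed (supp \<Omega> (u l))" by (simp add: supp_def)
    have cpt: "compact (supp \<Omega> (u l))"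
      using sub cl Omega(3) bounded_subset compact_eq_bounded_closed by blast
    \<comment> \<open>The support is compact in \<Omega>, so its whole frontier is free
      boundary.\<close>
    have "free_boundary \<Omega> (u l) = frontier (supp \<Omega> (u l))"
      using sub frontier_subset_closed[OF cl] by (auto simp: free_boundary_def)
    then show "hausdorff_dist (free_boundary \<Omega> (u l)) (frontier Op) \<le> 2 * M * \<rho> l"
      "0 \<le> hausdorff_dist (free_boundary \<Omega> (u l)) (frontier Op)"
      using hausdorff_dist_frontier[OF Op(1) Op_bdd Op(3) cpt Op_supp[OF that(1)] supp_near[OF that(1)]
          \<rho>_pos[OF that(1)] that(3) e(2) ext] by simp_all
  qed
  show ?thesis
  proof (rule exI[of _ "2 * C0"], intro conjI exI[of _ "2 * M * C0"])
    show "0 < 2 * C0" "2 * C0 \<le> 2 * M * C0" using C0 e by auto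
    show "\<forall>\<^sub>F l in at_bot. closure Op \<subseteq> supp \<Omega> (u l) \<and>
        supp \<Omega> (u l) \<subseteq> {x \<in> \<Omega>. infdist x (closure Op) < 2 * C0 * \<bar>l\<bar> powr (- 1 / 2)}"
      using small by eventually_elim (use Op_supp incl in blast)
    show "\<forall>\<^sub>F l in at_bot. hausdorff_dist (supp \<Omega> (u l)) (closure Op) \<le> 2 * C0 * \<bar>l\<bar> powr (- 1 / 2)"
      using small
    proof eventually_elim
      case (elim l)
      then show ?case using hd(1)[of l] \<rho>_pos[of l] by (simp add: \<rho>_def)
    qed
    show "((\<lambda>l. hausdorff_dist (supp \<Omega> (u l)) (closure Op)) \<longlongrightarrow> 0) at_bot"
      by (rule tendsto_sandwich[OF _ _ tendsto_const \<rho>_lim])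
         (use small hd in \<open>auto elim!: eventually_mono\<close>)
    show "\<forall>\<^sub>F l in at_bot. hausdorff_dist (free_boundary \<Omega> (u l)) (frontier Op) \<le> 2 * M * C0 * \<bar>l\<bar> powr (- 1 / 2)"
      using small
    proof eventually_elim
      case (elim l)
      then have "hausdorff_dist (free_boundary \<Omega> (u l)) (frontier Op) \<le> 2 * M * \<rho> l"
        by (intro hd_frontier(1)) auto
      then show ?case by (simp add: \<rho>_def mult.assoc)
    qed
    show "((\<lambda>l. hausdorff_dist (free_boundary \<Omega> (u l)) (frontier Op)) \<longlongrightarrow> 0) at_bot"
      \<comment> \<open>The upper bound tends to zero with \<open>\<rho> l\<close>; the lower bound
        is the eventual nonnegativity in \<open>hd_frontier\<close>.\<close>
      by (rule tendsto_sandwich[OF _ _ tendsto_const tendsto_mult_right_zero[OF \<rho>_lim, of "2 * M"]])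
         (use small hd_frontier in \<open>auto elim!: eventually_mono\<close>)
  qed
qed

end
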